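(* Let $F=K(x,y)$ be the Kummer extension defined by $y^m=f(x)^{\lambda}$, where $f(x)\in\mathbb{F}_q[x]$ is a separable polynomial of degree $r$ and $\gcd(m,r\lambda)=1$. Let $P\neq P_\infty$ be a place of $F$ that is totally ramified in $F/K(x)$, and let $(a,b)\in\mathbb{N}^2$. Then $(a,b)$ is a pure gap at $(P_\infty,P)$ if and only if, for every $t\in\{0,\dots,m-1\}$, exactly one of the following two conditions is satisfied: (1) $\left\lfloor\frac{a-rt}{m}\right\rfloor+\left\lfloor\frac{b+t}{m}\right\rfloor<0$; (2) $\left\lfloor\frac{a-rt}{m}\right\rfloor+\left\lfloor\frac{b+t}{m}\right\rfloor\ge 0$ and $\left\lfloor\frac{a-rt}{m}\right\rfloor+\left\lfloor\frac{b+t}{m}\right\rfloor=\left\lfloor\frac{a-1-rt}{m}\right\rfloor+\left\lfloor\frac{b-1+t}{m}\right\rfloor$.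
   Context: $\mathbb{F}_q$ is a finite field of characteristic $p$ and $K$ is its algebraic closure. A Kummer extension here means the algebraic function field $F=K(x,y)$ over $K$ (with $x$ transcendental over $K$) defined by $y^m=f(x)^{\lambda}=\prod_{i=1}^r (x-\alpha_i)^\lambda$, where $m\ge 2$, $p\nmid m$, $\lambda$ is a positive integer, $f(x)\in\mathbb{F}_q[x]$, the elements $\alpha_1,\dots,\alpha_r\in K$ are pairwise distinct, and $\gcd(m,r\lambda)=1$. The places $Q_1,\dots,Q_r$ of $K(x)$ corresponding to the zeros $\alpha_1,\dots,\alpha_r$ of $f$ and the pole $Q_\infty$ of $x$ in $K(x)$ are totally ramified in $F/K(x)$; $P_i$ denotes the unique place of $F$ over $Q_i$, for $i=1,\dots,r,\infty$. $\mathbb{N}$ is the set of positive integers. For a divisor $D$ of $F$, $\mathcal{L}(D)=\{z\in F\mid (z)\ge -D\}\cup\{0\}$ and $\ell(D)=\dim_K\mathcal{L}(D)$. For distinct places $R_1,R_2$ of $F$, a pair of non-negative integers $(s_1,s_2)$ is a pure gap at $(R_1,R_2)$ if $\ell(s_1R_1+s_2R_2)=\ell((s_1-1)R_1+s_2R_2)=\ell(s_1R_1+(s_2-1)R_2)$. *)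

theory Defs
  imports
    "HOL-Algebra.Algebraic_Closure_Type"
    "HOL-Computational_Algebra.Computational_Algebra"
    "HOL-Library.Poly_Mapping"
begin

section \<open>Field extensions\<close>

text \<open>An extension of fields is given by an embedding of one field type into another.\<close>

locale field_embedding =
  fixes emb :: "'k::field \<Rightarrow> 'f::field"
  assumes emb_one: "emb 1 = 1"
    and emb_add: "emb (c + d) = emb c + emb d"
    and emb_mult: "emb (c * d) = emb c * emb d"

definition is_subfield :: "'f::field set \<Rightarrow> bool" where
  "is_subfield S \<longleftrightarrow> 1 \<in> S \<and>
     (\<forall>a\<in>S. \<forall>b\<in>S. a - b \<in> S \<and> a * b \<in> S) \<and> (\<forall>a\<in>S. inverse a \<in> S)"

definition adjoin :: "('k::field \<Rightarrow> 'f::field) \<Rightarrow> 'f set \<Rightarrow> 'f set" where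
  "adjoin emb A = is_subfield hull (range emb \<union> A)"

definition dimension_over :: "('k::field \<Rightarrow> 'f::field) \<Rightarrow> 'f set \<Rightarrow> nat" where
  "dimension_over emb V = vector_space.dim (\<lambda>c z. emb c * z) V"

abbreviation extension_degree :: "('k::field \<Rightarrow> 'f::field) \<Rightarrow> nat" where
  "extension_degree emb \<equiv> dimension_over emb UNIV"


section \<open>Places of a function field\<close>

text \<open>
  The functions below take the embedding \<open>emb\<close> of the field of constants \<open>K\<close> into the
  function field \<open>F\<close>, which is a whole type.
\<close>

definition valuation_ring :: "('k::field \<Rightarrow> 'f::field) \<Rightarrow> 'f set \<Rightarrow> bool" where
  "valuation_ring emb R \<longleftrightarrow>
     1 \<in> R \<and> (\<forall>a\<in>R. \<forall>b\<in>R. a - b \<in> R \<and> a * b \<in> R) \<and>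
     range emb \<subset> R \<and> R \<subset> UNIV \<and> (\<forall>z. z \<in> R \<or> inverse z \<in> R)"

definition ideal_of :: "'f::field set \<Rightarrow> 'f set \<Rightarrow> bool" where
  "ideal_of I R \<longleftrightarrow> I \<subseteq> R \<and> 0 \<in> I \<and>
     (\<forall>a\<in>I. \<forall>b\<in>I. a - b \<in> I) \<and> (\<forall>a\<in>I. \<forall>c\<in>R. c * a \<in> I)"

definition maximal_ideal_of :: "'f::field set \<Rightarrow> 'f set \<Rightarrow> bool" where
  "maximal_ideal_of I R \<longleftrightarrow> ideal_of I R \<and> I \<noteq> R \<and>
     (\<forall>J. ideal_of J R \<longrightarrow> I \<subseteq> J \<longrightarrow> J = I \<or> J = R)"

definition place :: "('k::field \<Rightarrow> 'f::field) \<Rightarrow> 'f set \<Rightarrow> bool" where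
  "place emb P \<longleftrightarrow> (\<exists>R. valuation_ring emb R \<and> maximal_ideal_of P R)"

definition ring_of_place :: "('k::field \<Rightarrow> 'f::field) \<Rightarrow> 'f set \<Rightarrow> 'f set" where
  "ring_of_place emb P = (THE R. valuation_ring emb R \<and> maximal_ideal_of P R)"

text \<open>
  The valuation at \<open>P\<close> of a nonzero \<open>z\<close> is the \<open>n\<close> such that \<open>z = t\<^sup>n u\<close> with \<open>t\<close> a generator
  of \<open>P\<close> and \<open>u\<close> a unit of the valuation ring. The value at \<open>0\<close> (by convention infinite)
  is unspecified and never used.
\<close>

definition valuation :: "('k::field \<Rightarrow> 'f::field) \<Rightarrow> 'f set \<Rightarrow> 'f \<Rightarrow> int" where
  "valuation emb P z = (THE n. \<exists>t u.
     P = {t * w | w. w \<in> ring_of_place emb P} \<and>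
     u \<in> ring_of_place emb P \<and> inverse u \<in> ring_of_place emb P \<and> u \<noteq> 0 \<and>
     z = t powi n * u)"

definition pole_of :: "('k::field \<Rightarrow> 'f::field) \<Rightarrow> 'f set \<Rightarrow> 'f \<Rightarrow> bool" where
  "pole_of emb P z \<longleftrightarrow> place emb P \<and> z \<noteq> 0 \<and> valuation emb P z < 0"


section \<open>Riemann--Roch spaces and pure gaps\<close>

text \<open>
  A divisor is a finitely supported integer-valued function on places; its values at sets
  that are not places are irrelevant.
\<close>

definition RR_space :: "('k::field \<Rightarrow> 'f::field) \<Rightarrow> ('f set \<Rightarrow>\<^sub>0 int) \<Rightarrow> 'f set" where
  "RR_space emb D =
     {z. z \<noteq> 0 \<and> (\<forall>P. place emb P \<longrightarrow> valuation emb P z \<ge> - Poly_Mapping.lookup D P)} \<union> {0}"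

definition RR_dim :: "('k::field \<Rightarrow> 'f::field) \<Rightarrow> ('f set \<Rightarrow>\<^sub>0 int) \<Rightarrow> nat" where
  "RR_dim emb D = dimension_over emb (RR_space emb D)"

definition pure_gap ::
  "('k::field \<Rightarrow> 'f::field) \<Rightarrow> 'f set \<Rightarrow> 'f set \<Rightarrow> nat \<Rightarrow> nat \<Rightarrow> bool" where
  "pure_gap emb R1 R2 s1 s2 \<longleftrightarrow>
     (let l = (\<lambda>k1 k2 :: int. RR_dim emb (Poly_Mapping.single R1 k1 + Poly_Mapping.single R2 k2))
      in l (int s1) (int s2) = l (int s1 - 1) (int s2) \<and>
         l (int s1) (int s2) = l (int s1) (int s2 - 1))"


section \<open>Extensions of the rational function field\<close>

text \<open>
  \<open>K(x)\<close> is the fraction field of the polynomial ring over \<open>K\<close>; an extension \<open>F\<close> of it is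
  given by an embedding \<open>\<phi>\<close>, so the element \<open>x\<close> of \<open>F\<close>, which is automatically
  transcendental over \<open>K\<close>, is \<open>\<phi> ratfun_x\<close>.
\<close>

definition ratfun_const :: "'k::field \<Rightarrow> 'k poly fract" where
  "ratfun_const c = to_fract [:c:]"

definition ratfun_x :: "'k::field poly fract" where
  "ratfun_x = to_fract [:0, 1:]"

abbreviation const_emb :: "('k::field poly fract \<Rightarrow> 'f::field) \<Rightarrow> 'k \<Rightarrow> 'f" where
  "const_emb \<phi> \<equiv> \<phi> \<circ> ratfun_const"

text \<open>\<open>P\<close> is a place of \<open>F\<close> and \<open>Q\<close> a place of \<open>K(x)\<close>.\<close>

definition lies_over ::
  "('k::field poly fract \<Rightarrow> 'f::field) \<Rightarrow> 'f set \<Rightarrow> 'k poly fract set \<Rightarrow> bool" where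
  "lies_over \<phi> P Q \<longleftrightarrow>
     place (const_emb \<phi>) P \<and> place ratfun_const Q \<and> \<phi> ` Q \<subseteq> P"

definition ramification_index ::
  "('k::field poly fract \<Rightarrow> 'f::field) \<Rightarrow> 'f set \<Rightarrow> 'k poly fract set \<Rightarrow> nat" where
  "ramification_index \<phi> P Q = (THE e. \<forall>z. z \<noteq> 0 \<longrightarrow>
     valuation (const_emb \<phi>) P (\<phi> z) = int e * valuation ratfun_const Q z)"

definition totally_ramified :: "('k::field poly fract \<Rightarrow> 'f::field) \<Rightarrow> 'f set \<Rightarrow> bool" where
  "totally_ramified \<phi> P \<longleftrightarrow> (\<exists>Q. lies_over \<phi> P Q \<and> (\<forall>P'. lies_over \<phi> P' Q \<longrightarrow> P' = P) \<and>
     ramification_index \<phi> P Q = extension_degree \<phi>)"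

text \<open>
  The finite field is the type \<open>'q\<close>, and \<open>K\<close> is its algebraic closure. That
  \<open>Y\<^sup>m - f(x)\<^sup>\<lambda>\<close> is irreducible over \<open>K(x)\<close>, i.e. that \<open>[F : K(x)] = m\<close>, is a consequence
  of the coprimality condition.
\<close>

locale kummer_extension = field_embedding \<phi>
  for \<phi> :: "'q::{field,finite} alg_closure poly fract \<Rightarrow> 'f::field" +
  fixes y :: 'f
    and m lam r :: nat
    and f :: "'q poly"
    and \<alpha> :: "nat \<Rightarrow> 'q alg_closure"
  assumes m_ge_2: "m \<ge> 2"
    and char_not_dvd: "\<not> CHAR('q) dvd m"
    and lam_pos: "lam > 0"
    and coprime_m: "coprime m (r * lam)"
    and inj_alpha: "inj_on \<alpha> {1..r}"
    and f_factors: "map_poly to_ac f ^ lam = (\<Prod>i\<in>{1..r}. [:- \<alpha> i, 1:] ^ lam)"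
    and y_power: "y ^ m = \<phi> (to_fract (map_poly to_ac f ^ lam))"
    and generated: "adjoin \<phi> {y} = UNIV"

end

theory Submission
  imports Defs
begin

text \<open>
  Since \<open>\<lambda>\<close> is prime to \<open>m\<close>, the field \<open>F\<close> is also generated by a \<open>z\<close> with \<open>z\<^sup>m = f\<close>. Write \<open>\<alpha>\<close>
  for the root of \<open>f\<close> below \<open>P\<close>. The space \<open>L(k\<^sub>1 P\<^sub>\<infinity> + k\<^sub>2 P)\<close> has a basis of the monomials
  \<open>(x - \<alpha>)\<^sup>j z\<^sup>t\<close> with \<open>0 \<le> t < m\<close>, \<open>m j + t \<ge> - k\<^sub>2\<close> and \<open>m j + r t \<le> k\<^sub>1\<close>. For fixed \<open>t\<close> these are the
  \<open>j\<close> from \<open>- \<lfloor>(k\<^sub>2 + t) / m\<rfloor>\<close> to \<open>\<lfloor>(k\<^sub>1 - r t) / m\<rfloor>\<close>. Hence \<open>(a, b)\<close> is a pure gap if and only if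
  none of these intervals shrinks when \<open>a\<close> or \<open>b\<close> is decreased by 1, that is, for each \<open>t\<close> the
  interval is empty or its two ends stay where they are. This is the stated condition.

  That the monomials form a basis rests on three facts. (i) At the places over infinity and over
  the roots of \<open>f\<close>, the value of \<open>z\<close> is prime to \<open>m\<close> while the values of rational functions are
  divisible by \<open>m\<close>. So the terms of \<open>\<Sum> g\<^sub>t z\<^sup>t\<close> have distinct values, and the sum has the smallest of
  them (\<open>ramified_valuation_sum\<close>). This gives the uniqueness of these places, the independence of
  the monomials, and the bounds on each \<open>g\<^sub>t\<close> there. (ii) At the other places the absence of poles
  passes from the sum to its terms by averaging over the automorphisms \<open>z \<mapsto> \<zeta> z\<close> with
  \<open>\<zeta>\<^sup>m = 1\<close> (\<open>average_conjugate\<close>, \<open>coordinates_RR_space\<close>). (iii) A rational function with poles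
  only at \<open>\<alpha>\<close> and at infinity is a combination of powers of \<open>x - \<alpha>\<close> (\<open>ex_laurent_expansion\<close>). The
  same automorphisms show that a place over a point that is not a root of \<open>f\<close> is never alone, so
  \<open>P\<close> lies over a root (\<open>totally_ramified_imp_over_root\<close>).

  Two general facts about places are needed. All of them are discrete
  (\<open>ex_discrete_valuation\<close>): the powers \<open>1, h, \<dots>, h\<^sup>m\<close> are dependent over \<open>K(x)\<close>, and two terms
  of a relation must have the same value, so the values of \<open>K(x)\<close> have bounded index in
  those of \<open>F\<close>. And there is a place over each \<open>\<beta>\<close> in \<open>K\<close>
  (\<open>ex_valuation_ring_over_point\<close>), by Chevalley's extension argument.
\<close>


section \<open>Valuation rings of a field\<close>

locale valuation_subring =
  fixes R :: "'f::field set"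
  assumes one_mem: "1 \<in> R"
    and diff_mem: "a \<in> R \<Longrightarrow> b \<in> R \<Longrightarrow> a - b \<in> R"
    and mult_mem: "a \<in> R \<Longrightarrow> b \<in> R \<Longrightarrow> a * b \<in> R"
    and mem_or_inverse_mem: "z \<in> R \<or> inverse z \<in> R"

definition nonunits :: "'f::field set \<Rightarrow> 'f set" where
  "nonunits R = {z \<in> R. z = 0 \<or> inverse z \<notin> R}"

definition unit_in :: "'f::field set \<Rightarrow> 'f \<Rightarrow> bool" where
  "unit_in R u \<longleftrightarrow> u \<noteq> 0 \<and> u \<in> R \<and> inverse u \<in> R"

context valuation_subring
begin

lemma zero_mem: "0 \<in> R"
  using diff_mem[OF one_mem one_mem] by simp

lemma uminus_mem: "a \<in> R \<Longrightarrow> - a \<in> R"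
  using diff_mem[OF zero_mem] by simp

lemma add_mem: "a \<in> R \<Longrightarrow> b \<in> R \<Longrightarrow> a + b \<in> R"
  using diff_mem[of a "- b"] uminus_mem by simp

lemma sum_mem: "(\<And>i. i \<in> I \<Longrightarrow> h i \<in> R) \<Longrightarrow> sum h I \<in> R"
  by (induction I rule: infinite_finite_induct) (auto intro: add_mem zero_mem)

lemma power_mem: "a \<in> R \<Longrightarrow> a ^ n \<in> R"
  by (induction n) (auto intro: mult_mem one_mem)

lemma mem_nonunits_iff: "z \<noteq> 0 \<Longrightarrow> z \<in> nonunits R \<longleftrightarrow> inverse z \<notin> R"
  using mem_or_inverse_mem[of z] by (auto simp: nonunits_def)

lemma zero_mem_nonunits: "0 \<in> nonunits R"
  by (simp add: nonunits_def zero_mem)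

lemma one_notin_nonunits: "1 \<notin> nonunits R"
  by (simp add: nonunits_def one_mem)

lemma nonunits_subset: "nonunits R \<subseteq> R"
  by (auto simp: nonunits_def)

lemma unit_in_iff: "u \<in> R \<Longrightarrow> unit_in R u \<longleftrightarrow> u \<notin> nonunits R"
  by (auto simp: nonunits_def unit_in_def zero_mem)

lemma mult_nonunits:
  assumes "a \<in> nonunits R" "c \<in> R"
  shows "c * a \<in> nonunits R"
proof (cases "c * a = 0")
  case True
  then show ?thesis using zero_mem_nonunits by (auto simp del: mult_eq_0_iff)
next
  case False
  have "inverse (c * a) \<notin> R"
  proof
    assume "inverse (c * a) \<in> R"
    from mult_mem[OF assms(2) this] have "inverse a \<in> R"
      using False by (simp add: field_simps)
    with assms(1) False show False by (auto simp: nonunits_def)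
  qed
  then show ?thesis using False by (simp add: mem_nonunits_iff)
qed

lemma uminus_nonunits: "a \<in> nonunits R \<Longrightarrow> - a \<in> nonunits R"
  using mult_nonunits[of a "- 1"] uminus_mem[OF one_mem] by simp

text \<open>Of two nonunits one divides the other, so their sum is a multiple of one of them.\<close>

lemma add_nonunits:
  assumes "a \<in> nonunits R" "b \<in> nonunits R"
  shows "a + b \<in> nonunits R"
proof (cases "a = 0 \<or> b = 0")
  case True
  then show ?thesis using assms by auto
next
  case False
  have *: "c + d \<in> nonunits R" if "c \<in> nonunits R" "c \<noteq> 0" "d / c \<in> R" for c d
  proof -
    have "(1 + d / c) * c \<in> nonunits R"
      using that by (intro mult_nonunits add_mem one_mem)
    also have "(1 + d / c) * c = c + d" using that by (simp add: field_simps)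
    finally show ?thesis .
  qed
  have "inverse (a / b) = b / a" by simp
  then have "a / b \<in> R \<or> b / a \<in> R"
    using mem_or_inverse_mem[of "a / b"] by simp
  then show ?thesis
    using *[of a b] *[of b a] assms False by (auto simp: add.commute)
qed

lemma diff_nonunits: "a \<in> nonunits R \<Longrightarrow> b \<in> nonunits R \<Longrightarrow> a - b \<in> nonunits R"
  using add_nonunits[OF _ uminus_nonunits, of a b] by simp

lemma sum_nonunits: "(\<And>i. i \<in> I \<Longrightarrow> h i \<in> nonunits R) \<Longrightarrow> sum h I \<in> nonunits R"
  by (induction I rule: infinite_finite_induct) (auto intro: add_nonunits zero_mem_nonunits)

lemma unit_in_one: "unit_in R 1"
  by (simp add: unit_in_def one_mem)

lemma unit_in_mult: "unit_in R u \<Longrightarrow> unit_in R v \<Longrightarrow> unit_in R (u * v)"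
  by (auto simp: unit_in_def mult_mem)

lemma unit_in_inverse: "unit_in R u \<Longrightarrow> unit_in R (inverse u)"
  by (auto simp: unit_in_def)

lemma unit_in_divide: "unit_in R u \<Longrightarrow> unit_in R v \<Longrightarrow> unit_in R (u / v)"
  using unit_in_mult[OF _ unit_in_inverse, of u v] by (simp add: field_simps)

lemma unit_in_power: "unit_in R u \<Longrightarrow> unit_in R (u ^ n)"
  by (induction n) (auto intro: unit_in_mult unit_in_one)

lemma unit_in_power_int: "unit_in R u \<Longrightarrow> unit_in R (u powi n)"
  by (auto simp: power_int_def intro: unit_in_power unit_in_inverse)

lemma unit_in_add_nonunit:
  assumes "unit_in R u" "a \<in> nonunits R"
  shows "unit_in R (u + a)"
proof -
  have "u \<in> R" "u \<notin> nonunits R"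
    using assms(1) by (auto simp: unit_in_def nonunits_def)
  moreover have "u + a \<notin> nonunits R"
    using diff_nonunits[of "u + a" a] assms(2) \<open>u \<notin> nonunits R\<close> by auto
  ultimately show ?thesis
    using assms(2) nonunits_subset by (subst unit_in_iff) (auto intro: add_mem)
qed

lemma nonunits_prime:
  assumes "a * b \<in> nonunits R" "a \<in> R" "b \<in> R"
  shows "a \<in> nonunits R \<or> b \<in> nonunits R"
  using assms unit_in_mult[of a b] mult_mem[of a b] by (metis unit_in_iff)

lemma power_nonunits: "a \<in> nonunits R \<Longrightarrow> n > 0 \<Longrightarrow> a ^ n \<in> nonunits R"
  using mult_nonunits[of a "a ^ (n - 1)"] nonunits_subset
  by (cases n) (auto intro: power_mem simp: mult.commute)

text \<open>
  If \<open>z\<close> were not in \<open>R\<close>, then \<open>z\<^sup>n\<close> would be the inverse of a nonunit. This is the part of the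
  integral closedness of \<open>R\<close> that concerns roots.
\<close>

lemma mem_if_power_mem:
  assumes "z ^ n \<in> R" "n > 0"
  shows "z \<in> R"
proof (rule ccontr)
  assume z: "z \<notin> R"
  then have "z \<noteq> 0" using zero_mem by auto
  then have "inverse z \<in> nonunits R"
    using z by (subst mem_nonunits_iff) auto
  then have "z ^ n * inverse z ^ n \<in> nonunits R"
    using assms by (intro mult_nonunits power_nonunits)
  also have "z ^ n * inverse z ^ n = 1"
    using \<open>z \<noteq> 0\<close> by (simp flip: power_mult_distrib)
  finally show False using one_notin_nonunits by simp
qed

lemma power_mem_iff: "n > 0 \<Longrightarrow> z ^ n \<in> R \<longleftrightarrow> z \<in> R"
  using mem_if_power_mem power_mem by blast

text \<open>
  If one term alone had the smallest value, dividing the sum by it would give a unit plus nonunits,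
  which is not zero.
\<close>

lemma vanishing_sum_has_associated_terms:
  assumes "finite I" "(\<Sum>i\<in>I. h i) = 0" "k \<in> I" "h k \<noteq> 0"
  shows "\<exists>i\<in>I. \<exists>j\<in>I. i \<noteq> j \<and> h i \<noteq> 0 \<and> h j \<noteq> 0 \<and> unit_in R (h i / h j)"
proof -
  have ex_max: "\<exists>j\<in>J. \<forall>i\<in>J. h i / h j \<in> R"
    if "finite J" "J \<noteq> {}" "\<forall>i\<in>J. h i \<noteq> 0" for J
    using that
  proof (induction J rule: finite_ne_induct)
    case (singleton i)
    then show ?case by (simp add: one_mem)
  next
    case (insert l J)
    then obtain j where j: "j \<in> J" "\<forall>i\<in>J. h i / h j \<in> R" by auto
    consider "h l / h j \<in> R" | "h j / h l \<in> R"
      using mem_or_inverse_mem[of "h l / h j"] by auto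
    then show ?case
    proof cases
      case 1
      then show ?thesis using j by blast
    next
      case 2
      have "h i / h l \<in> R" if "i \<in> J" for i
      proof -
        have "(h i / h j) * (h j / h l) \<in> R" using that j 2 by (intro mult_mem) auto
        also have "(h i / h j) * (h j / h l) = h i / h l" using insert.prems j by auto
        finally show ?thesis .
      qed
      then show ?thesis using insert.prems by (auto simp: one_mem)
    qed
  qed
  define J where "J = {i \<in> I. h i \<noteq> 0}"
  have "finite J" "J \<noteq> {}" "\<forall>i\<in>J. h i \<noteq> 0"
    using assms by (auto simp: J_def)
  from ex_max[OF this] obtain j
    where j: "j \<in> I" "h j \<noteq> 0" "\<And>i. i \<in> I \<Longrightarrow> h i \<noteq> 0 \<Longrightarrow> h i / h j \<in> R"
    by (auto simp: J_def)
  show ?thesis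
  proof (rule ccontr)
    assume no: "\<not> ?thesis"
    have "h i / h j \<in> nonunits R" if "i \<in> I - {j}" for i
    proof (cases "h i = 0")
      case True
      then show ?thesis by (simp add: zero_mem_nonunits)
    next
      case False
      then have "\<not> unit_in R (h i / h j)" using no j that by auto
      then show ?thesis using j that False by (simp add: unit_in_iff)
    qed
    then have "(\<Sum>i\<in>I - {j}. h i / h j) \<in> nonunits R" by (rule sum_nonunits)
    also have "(\<Sum>i\<in>I - {j}. h i / h j) = (\<Sum>i\<in>I. h i / h j) - 1"
      using assms j by (subst sum.remove[of I j]) auto
    also have "(\<Sum>i\<in>I. h i / h j) = 0"
      using assms by (simp flip: sum_divide_distrib)
    finally have "- (1 :: 'f) \<in> nonunits R" by simp
    then show False
      using uminus_nonunits[of "- 1"] one_notin_nonunits by simp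
  qed
qed

end


section \<open>Discrete valuations\<close>

locale discrete_valuation = valuation_subring R for R :: "'f::field set" +
  fixes w :: "'f \<Rightarrow> int"
  assumes w_mult: "a \<noteq> 0 \<Longrightarrow> b \<noteq> 0 \<Longrightarrow> w (a * b) = w a + w b"
    and mem_iff: "a \<noteq> 0 \<Longrightarrow> a \<in> R \<longleftrightarrow> 0 \<le> w a"
    and ex_uniformizer: "\<exists>t. t \<noteq> 0 \<and> w t = 1"
begin

lemma w_one: "w 1 = 0"
  using w_mult[of 1 1] by simp

lemma w_inverse: "a \<noteq> 0 \<Longrightarrow> w (inverse a) = - w a"
  using w_mult[of a "inverse a"] w_one by simp

lemma w_divide: "a \<noteq> 0 \<Longrightarrow> b \<noteq> 0 \<Longrightarrow> w (a / b) = w a - w b"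
  using w_mult[of a "inverse b"] w_inverse by (simp add: field_simps)

lemma w_power: "a \<noteq> 0 \<Longrightarrow> w (a ^ n) = int n * w a"
  by (induction n) (auto simp: w_one w_mult algebra_simps)

lemma w_power_int: "a \<noteq> 0 \<Longrightarrow> w (a powi n) = n * w a"
  by (auto simp: power_int_def w_power w_inverse)

lemma unit_in_iff_w: "unit_in R a \<longleftrightarrow> a \<noteq> 0 \<and> w a = 0"
  using mem_iff[of a] mem_iff[of "inverse a"] w_inverse[of a] by (auto simp: unit_in_def)

lemma mem_nonunits_iff_w: "a \<noteq> 0 \<Longrightarrow> a \<in> nonunits R \<longleftrightarrow> w a > 0"
  using mem_nonunits_iff[of a] mem_iff[of "inverse a"] w_inverse[of a] by auto

lemma w_add_less:
  assumes "a \<noteq> 0" "b \<noteq> 0" "w a < w b"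
  shows "a + b \<noteq> 0 \<and> w (a + b) = w a"
proof -
  have "b / a \<in> nonunits R"
    using assms by (simp add: mem_nonunits_iff_w w_divide)
  then have "unit_in R (1 + b / a)"
    by (intro unit_in_add_nonunit unit_in_one)
  then have u: "1 + b / a \<noteq> 0" "w (1 + b / a) = 0"
    by (auto simp: unit_in_iff_w)
  have "a + b = a * (1 + b / a)" using assms by (simp add: field_simps)
  then show ?thesis using u assms by (simp add: w_mult)
qed

lemma w_sum_distinct:
  assumes "finite I" "I \<noteq> {}" "\<And>i. i \<in> I \<Longrightarrow> h i \<noteq> 0" "inj_on (\<lambda>i. w (h i)) I"
  shows "(\<Sum>i\<in>I. h i) \<noteq> 0 \<and> w (\<Sum>i\<in>I. h i) = Min ((\<lambda>i. w (h i)) ` I)"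
  using assms
proof (induction I rule: finite_ne_induct)
  case (singleton i)
  then show ?case by simp
next
  case (insert j I)
  define s where "s = (\<Sum>i\<in>I. h i)"
  have s: "s \<noteq> 0" "w s = Min ((\<lambda>i. w (h i)) ` I)"
    using insert by (auto simp: s_def)
  have "w s \<in> (\<lambda>i. w (h i)) ` I"
    unfolding s(2) using insert.hyps by (intro Min_in) auto
  then have "w s \<noteq> w (h j)"
    using insert.hyps(3) insert.prems(2) by (auto simp: inj_on_def)
  then have "h j + s \<noteq> 0 \<and> w (h j + s) = min (w (h j)) (w s)"
    using w_add_less[of "h j" s] w_add_less[of s "h j"] s(1) insert.prems(1)[of j]
    by (cases "w s < w (h j)") (auto simp: add.commute min_def)
  then show ?case
    using insert.hyps s by (simp add: s_def)
qed

end

text \<open>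
  If the value of every element is, up to a factor of at most \<open>N\<close>, a multiple of the value of
  \<open>\<tau>\<close>, then after multiplying by \<open>N!\<close> all values become integers, and the valuation is discrete.
  A uniformizer then shows that \<open>\<tau>\<close> itself has value at most \<open>N\<close>.
\<close>

lemma (in valuation_subring) discrete_valuation_if_bounded_index:
  assumes \<tau>: "\<tau> \<in> nonunits R" "\<tau> \<noteq> 0"
    and index: "\<And>h. h \<noteq> 0 \<Longrightarrow> \<exists>n\<in>{1..N}. \<exists>k. unit_in R (h ^ n / \<tau> powi k)"
  shows "\<exists>w. discrete_valuation R w \<and> w \<tau> \<in> {1..int N}"
proof -
  define L :: nat where "L = fact N"
  have [simp]: "L > 0" by (simp add: L_def)
  have powi_mem: "\<tau> powi k \<in> R \<longleftrightarrow> 0 \<le> k" for k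
  proof
    assume "0 \<le> k"
    then show "\<tau> powi k \<in> R"
      using \<tau> nonunits_subset by (auto simp: power_int_def intro: power_mem)
  next
    assume k: "\<tau> powi k \<in> R"
    show "0 \<le> k"
    proof (rule ccontr)
      assume "\<not> 0 \<le> k"
      then have "\<tau> ^ nat (- k) \<in> nonunits R"
        using \<tau> by (intro power_nonunits) auto
      moreover have "inverse (\<tau> ^ nat (- k)) \<in> R"
        using k \<open>\<not> 0 \<le> k\<close> by (simp add: power_int_def power_inverse)
      ultimately show False
        using \<tau> by (auto simp: nonunits_def)
    qed
  qed
  have "\<exists>k. unit_in R (h ^ L / \<tau> powi k)" if "h \<noteq> 0" for h
  proof -
    from index[OF that] obtain n k
      where nk: "n \<in> {1..N}" "unit_in R (h ^ n / \<tau> powi k)" by blast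
    then have "n dvd L" by (auto simp: L_def intro: dvd_fact)
    then obtain c where c: "L = n * c" by blast
    have "unit_in R ((h ^ n / \<tau> powi k) ^ c)"
      using nk by (intro unit_in_power)
    also have "(h ^ n / \<tau> powi k) ^ c = h ^ L / \<tau> powi (k * int c)"
      by (simp add: c power_divide power_mult power_int_mult)
    finally show ?thesis by blast
  qed
  \<comment> \<open>\<open>V\<close> is the value, scaled such that \<open>\<tau>\<close> has value \<open>N!\<close>.\<close>
  then obtain V where V: "unit_in R (h ^ L / \<tau> powi V h)" if "h \<noteq> 0" for h
    by metis
  have V_unique: "V h = k" if "h \<noteq> 0" "unit_in R (h ^ L / \<tau> powi k)" for h k
  proof -
    have "unit_in R ((h ^ L / \<tau> powi k) / (h ^ L / \<tau> powi V h))"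
      by (rule unit_in_divide[OF that(2) V[OF that(1)]])
    also have "(h ^ L / \<tau> powi k) / (h ^ L / \<tau> powi V h) = \<tau> powi (V h - k)"
      using that \<tau> by (simp add: power_int_diff)
    finally have "\<tau> powi (V h - k) \<in> R" "inverse (\<tau> powi (V h - k)) \<in> R"
      by (auto simp: unit_in_def)
    then show ?thesis
      using powi_mem[of "V h - k"] powi_mem[of "k - V h"]
      by (simp flip: power_int_minus)
  qed
  have V_mult: "V (a * b) = V a + V b" if "a \<noteq> 0" "b \<noteq> 0" for a b
  proof (rule V_unique)
    have "unit_in R ((a ^ L / \<tau> powi V a) * (b ^ L / \<tau> powi V b))"
      using that by (intro unit_in_mult[OF V V])
    then show "unit_in R ((a * b) ^ L / \<tau> powi (V a + V b))"
      using \<tau> by (simp add: power_int_add power_mult_distrib)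
  qed (use that in auto)
  have V_mem: "a \<in> R \<longleftrightarrow> 0 \<le> V a" if "a \<noteq> 0" for a
  proof -
    have u: "unit_in R (a ^ L / \<tau> powi V a)" using V that by blast
    have "a ^ L \<in> R \<longleftrightarrow> \<tau> powi V a \<in> R"
    proof
      assume "a ^ L \<in> R"
      then have "a ^ L * inverse (a ^ L / \<tau> powi V a) \<in> R"
        using u by (intro mult_mem) (auto simp: unit_in_def)
      then show "\<tau> powi V a \<in> R" using that by (simp add: field_simps)
    next
      assume "\<tau> powi V a \<in> R"
      then have "\<tau> powi V a * (a ^ L / \<tau> powi V a) \<in> R"
        using u by (intro mult_mem) (auto simp: unit_in_def)
      then show "a ^ L \<in> R" using that \<tau> by (simp add: field_simps)
    qed
    then show ?thesis using powi_mem by (simp add: power_mem_iff)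
  qed
  have V_\<tau>: "V \<tau> = int L"
    using \<tau> unit_in_one by (intro V_unique) auto
  have V_one: "V 1 = 0" using V_mult[of 1 1] by simp
  have V_inverse: "V (inverse a) = - V a" if "a \<noteq> 0" for a
    using V_mult[of a "inverse a"] V_one that by simp
  have V_power: "V (a ^ n) = int n * V a" if "a \<noteq> 0" for a n
    using that by (induction n) (auto simp: V_one V_mult algebra_simps)
  have V_powi: "V (a powi n) = n * V a" if "a \<noteq> 0" for a n
    using that by (auto simp: power_int_def V_power V_inverse)

  \<comment> \<open>The values of \<open>V\<close> form a subgroup of the integers, and \<open>d\<close> is its positive generator.\<close>
  define d where "d = (LEAST n. n > 0 \<and> (\<exists>a. a \<noteq> 0 \<and> V a = int n))"
  have "d > 0 \<and> (\<exists>a. a \<noteq> 0 \<and> V a = int d)"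
    unfolding d_def by (rule LeastI[of _ L]) (use V_\<tau> \<tau> in auto)
  then obtain t where d: "d > 0" and t: "t \<noteq> 0" "V t = int d" by blast
  have d_dvd: "int d dvd V a" if "a \<noteq> 0" for a
  proof -
    define q where "q = V a div int d"
    define b where "b = a / t powi q"
    have "b \<noteq> 0" using that t by (simp add: b_def)
    have "V b = V a - q * int d"
      using V_mult[of a "inverse (t powi q)"] V_powi[of t q] V_inverse[of "t powi q"] that t
      by (simp add: b_def divide_inverse)
    then have Vb: "V b = V a mod int d"
      by (simp add: q_def minus_div_mult_eq_mod)
    have "\<not> nat (V b) > 0"
    proof
      assume "nat (V b) > 0"
      then have "d \<le> nat (V b)"
        unfolding d_def using \<open>b \<noteq> 0\<close> by (intro Least_le) auto
      then show False using Vb d pos_mod_bound[of "int d" "V a"] by linarith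
    qed
    then have "V a mod int d = 0"
      using Vb d pos_mod_sign[of "int d" "V a"] by linarith
    then show ?thesis by (simp add: dvd_eq_mod_eq_0)
  qed
  define w where "w a = V a div int d" for a
  have V_w: "V a = int d * w a" if "a \<noteq> 0" for a
    using d_dvd[OF that] by (simp add: w_def)
  have dv: "discrete_valuation R w"
  proof unfold_locales
    show "w (a * b) = w a + w b" if "a \<noteq> 0" "b \<noteq> 0" for a b
      using V_mult[OF that] V_w[of a] V_w[of b] V_w[of "a * b"] that d
      by (simp flip: distrib_left)
    show "a \<in> R \<longleftrightarrow> 0 \<le> w a" if "a \<noteq> 0" for a
      using V_mem[OF that] V_w[OF that] d by (simp add: zero_le_mult_iff)
    show "\<exists>t. t \<noteq> 0 \<and> w t = 1"
      using t d by (auto simp: w_def)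
  qed
  then interpret discrete_valuation R w .
  have wt: "w t = 1" using t d by (simp add: w_def)
  have w_pos: "w \<tau> > 0" using \<tau> by (simp flip: mem_nonunits_iff_w)
  from index[OF t(1)] obtain n k
    where nk: "n \<in> {1..N}" "unit_in R (t ^ n / \<tau> powi k)" by blast
  then have n: "int n = k * w \<tau>"
    using t \<tau> wt by (auto simp: unit_in_iff_w w_divide w_power w_power_int)
  moreover have "int n > 0" using nk by auto
  ultimately have "k > 0" using w_pos by (metis zero_less_mult_pos2)
  then have "1 * w \<tau> \<le> k * w \<tau>" using w_pos by (intro mult_right_mono) auto
  then have "w \<tau> \<le> int N" using n nk by auto
  then show ?thesis using dv w_pos by auto
qed


section \<open>Places and their valuations\<close>

lemma valuation_ring_imp_valuation_subring:
  "valuation_ring emb R \<Longrightarrow> valuation_subring R"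
  by unfold_locales (auto simp: valuation_ring_def)

lemma maximal_ideal_of_iff_nonunits:
  assumes "valuation_subring R"
  shows "maximal_ideal_of P R \<longleftrightarrow> P = nonunits R"
proof -
  interpret valuation_subring R by fact
  have ideal: "ideal_of (nonunits R) R"
    by (auto simp: ideal_of_def zero_mem_nonunits nonunits_subset[THEN subsetD]
        intro: diff_nonunits mult_nonunits)
  have proper: "nonunits R \<noteq> R"
    using one_mem one_notin_nonunits by blast
  have le: "I \<subseteq> nonunits R" if "ideal_of I R" "I \<noteq> R" for I
  proof
    fix z
    assume z: "z \<in> I"
    show "z \<in> nonunits R"
    proof (rule ccontr)
      assume "z \<notin> nonunits R"
      then have u: "inverse z \<in> R" "z \<noteq> 0"
        using z that by (auto simp: nonunits_def ideal_of_def)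
      have "c \<in> I" if c: "c \<in> R" for c
      proof -
        have "(c * inverse z) * z \<in> I"
          using \<open>ideal_of I R\<close> z c u by (auto simp: ideal_of_def mult_mem)
        also have "(c * inverse z) * z = c" using u by simp
        finally show ?thesis .
      qed
      then have "I = R" using that by (auto simp: ideal_of_def)
      with that show False by simp
    qed
  qed
  show ?thesis
  proof
    assume "maximal_ideal_of P R"
    then show "P = nonunits R"
      using le[of P] ideal proper by (auto simp: maximal_ideal_of_def)
  next
    assume "P = nonunits R"
    then show "maximal_ideal_of P R"
      using le ideal proper by (auto simp: maximal_ideal_of_def)
  qed
qed

lemma valuation_subring_eq_if_nonunits_eq:
  assumes "valuation_subring R" "valuation_subring S" "nonunits R = nonunits S"
  shows "R = S"
proof -
  have "z \<in> T \<longleftrightarrow> z = 0 \<or> inverse z \<notin> nonunits T" if "valuation_subring T"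
    for T :: "'a set" and z
    using that valuation_subring.mem_nonunits_iff[of T "inverse z"]
      valuation_subring.zero_mem[of T] by auto
  with assms show ?thesis by (metis subsetI subset_antisym)
qed

lemma place_iff:
  "place emb P \<longleftrightarrow> (\<exists>R. valuation_ring emb R \<and> P = nonunits R)"
  unfolding place_def
  using maximal_ideal_of_iff_nonunits valuation_ring_imp_valuation_subring by blast

lemma ring_of_place_nonunits:
  assumes "valuation_ring emb R"
  shows "ring_of_place emb (nonunits R) = R"
  unfolding ring_of_place_def
proof (rule the_equality)
  have R: "valuation_subring R"
    using assms by (rule valuation_ring_imp_valuation_subring)
  then show "valuation_ring emb R \<and> maximal_ideal_of (nonunits R) R"
    using assms by (simp add: maximal_ideal_of_iff_nonunits)
  fix S
  assume S: "valuation_ring emb S \<and> maximal_ideal_of (nonunits R) S"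
  then have "valuation_subring S"
    by (blast intro: valuation_ring_imp_valuation_subring)
  then show "S = R"
    using S R valuation_subring_eq_if_nonunits_eq[of R S]
    by (simp add: maximal_ideal_of_iff_nonunits)
qed

text \<open>
  A generator of the maximal ideal is an element of value 1, so the valuation does not depend
  on the generator, and it is any discrete valuation that has \<open>R\<close> as its valuation ring.
\<close>

lemma valuation_nonunits:
  assumes "valuation_ring emb R" "discrete_valuation R w" "z \<noteq> 0"
  shows "valuation emb (nonunits R) z = w z"
proof -
  interpret discrete_valuation R w by fact
  have generator: "nonunits R = {t * c | c. c \<in> R}" if t: "t \<noteq> 0" "w t = 1" for t
  proof (intro equalityI subsetI)
    fix a
    assume a: "a \<in> nonunits R"
    show "a \<in> {t * c | c. c \<in> R}"
    proof (cases "a = 0")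
      case True
      then show ?thesis using zero_mem by force
    next
      case False
      then have "a / t \<in> R"
        using a t by (simp add: mem_iff w_divide mem_nonunits_iff_w)
      moreover have "a = t * (a / t)" using t by simp
      ultimately show ?thesis by blast
    qed
  next
    fix a
    assume "a \<in> {t * c | c. c \<in> R}"
    then obtain c where c: "c \<in> R" "a = c * t" by (auto simp: mult.commute)
    show "a \<in> nonunits R"
      unfolding c(2) by (intro mult_nonunits c) (simp add: mem_nonunits_iff_w t)
  qed
  obtain t where t: "t \<noteq> 0" "w t = 1" using ex_uniformizer by blast
  show ?thesis
    unfolding valuation_def ring_of_place_nonunits[OF assms(1)]
  proof (rule the_equality, intro exI conjI)
    let ?u = "z / t powi w z"
    have u: "unit_in R ?u"
      using t assms by (simp add: unit_in_iff_w w_divide w_power_int)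
    show "nonunits R = {t * c | c. c \<in> R}" by (rule generator[OF t])
    show "?u \<in> R" "inverse ?u \<in> R" "?u \<noteq> 0" using u by (auto simp: unit_in_def)
    show "z = t powi w z * ?u" using t by simp
  next
    fix n
    assume "\<exists>s u. nonunits R = {s * w | w. w \<in> R} \<and> u \<in> R \<and> inverse u \<in> R \<and> u \<noteq> 0 \<and>
      z = s powi n * u"
    then obtain s u where s: "nonunits R = {s * c | c. c \<in> R}" and u: "unit_in R u"
      and z: "z = s powi n * u" by (auto simp: unit_in_def)
    have "t \<in> nonunits R" using t by (simp add: mem_nonunits_iff_w)
    then obtain c where c: "c \<in> R" "t = s * c" using s by auto
    have "s * 1 \<in> nonunits R" using s one_mem by blast
    moreover have nz: "s \<noteq> 0" "c \<noteq> 0" using c t by auto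
    ultimately have "w s > 0" by (simp add: mem_nonunits_iff_w)
    moreover have "w s + w c = 1" "w c \<ge> 0"
      using t c nz by (auto simp: w_mult mem_iff)
    ultimately have "w s = 1" by linarith
    then show "n = w z"
      using u nz unfolding z by (simp add: w_mult w_power_int unit_in_iff_w)
  qed
qed


section \<open>Extensions of a rational function field\<close>

context field_embedding
begin

lemma emb_zero [simp]: "emb 0 = 0"
  using emb_add[of 0 0] add_cancel_right_right[of "emb 0" "emb 0"] by simp

lemma emb_uminus: "emb (- c) = - emb c"
  using emb_add[of c "- c"] by (simp add: eq_neg_iff_add_eq_0 add.commute)

lemma emb_diff: "emb (c - d) = emb c - emb d"
  using emb_add[of c "- d"] by (simp add: emb_uminus)

lemma emb_eq_0_iff [simp]: "emb c = 0 \<longleftrightarrow> c = 0"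
proof
  assume "emb c = 0"
  show "c = 0"
  proof (rule ccontr)
    assume "c \<noteq> 0"
    then show False
      using emb_mult[of c "inverse c"] \<open>emb c = 0\<close> by (simp add: emb_one)
  qed
qed simp

lemma emb_inverse: "emb (inverse c) = inverse (emb c)"
proof (cases "c = 0")
  case False
  then show ?thesis
    using emb_mult[of c "inverse c"] by (simp add: emb_one inverse_unique)
qed simp

lemma emb_divide: "emb (c / d) = emb c / emb d"
  by (simp add: divide_inverse emb_mult emb_inverse)

lemma emb_power: "emb (c ^ n) = emb c ^ n"
  by (induction n) (auto simp: emb_one emb_mult)

lemma emb_power_int: "emb (c powi n) = emb c powi n"
  by (auto simp: power_int_def emb_power emb_inverse)

lemma emb_sum: "emb (sum h I) = (\<Sum>i\<in>I. emb (h i))"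
  by (induction I rule: infinite_finite_induct) (auto simp: emb_add)

lemma vector_space_emb: "vector_space (\<lambda>c z. emb c * z)"
  by unfold_locales (auto simp: emb_one emb_mult emb_add algebra_simps)

end

text \<open>
  A function \<open>\<omega>\<close> on nonzero polynomials that turns products into sums extends to quotients.
  Both the order at a point and the degree arise in this way.
\<close>

definition fract_ord :: "('a::idom \<Rightarrow> nat) \<Rightarrow> 'a fract \<Rightarrow> int" where
  "fract_ord \<omega> c = (THE n. \<exists>p q. p \<noteq> 0 \<and> q \<noteq> 0 \<and> c = to_fract p / to_fract q \<and>
     n = int (\<omega> p) - int (\<omega> q))"

lemma fract_ord_divide:
  assumes "\<And>p q. p \<noteq> 0 \<Longrightarrow> q \<noteq> 0 \<Longrightarrow> \<omega> (p * q) = \<omega> p + \<omega> q" "p \<noteq> 0" "q \<noteq> 0"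
  shows "fract_ord \<omega> (to_fract p / to_fract q) = int (\<omega> p) - int (\<omega> q)"
  unfolding fract_ord_def
proof (rule the_equality)
  show "\<exists>p' q'. p' \<noteq> 0 \<and> q' \<noteq> 0 \<and> to_fract p / to_fract q = to_fract p' / to_fract q' \<and>
      int (\<omega> p) - int (\<omega> q) = int (\<omega> p') - int (\<omega> q')"
    using assms by blast
  fix n
  assume "\<exists>p' q'. p' \<noteq> 0 \<and> q' \<noteq> 0 \<and> to_fract p / to_fract q = to_fract p' / to_fract q' \<and>
      n = int (\<omega> p') - int (\<omega> q')"
  then obtain p' q' where *: "p' \<noteq> 0" "q' \<noteq> 0" "n = int (\<omega> p') - int (\<omega> q')"
    "to_fract p / to_fract q = to_fract p' / to_fract q'" by blast
  then have "to_fract (p * q') = to_fract (p' * q)"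
    using assms by (simp add: field_simps)
  then have "\<omega> (p * q') = \<omega> (p' * q)" by (simp del: to_fract_mult)
  then show "n = int (\<omega> p) - int (\<omega> q)"
    using * assms by simp
qed

definition ord_at :: "'k::field \<Rightarrow> 'k poly fract \<Rightarrow> int" where
  "ord_at \<beta> = fract_ord (order \<beta>)"

definition ord_inf :: "'k::field poly fract \<Rightarrow> int" where
  "ord_inf c = - fract_ord Polynomial.degree c"

lemma ord_at_divide:
  "p \<noteq> 0 \<Longrightarrow> q \<noteq> 0 \<Longrightarrow> ord_at \<beta> (to_fract p / to_fract q) = int (order \<beta> p) - int (order \<beta> q)"
  unfolding ord_at_def by (rule fract_ord_divide) (auto simp: order_mult)

lemma ord_inf_divide:
  "p \<noteq> 0 \<Longrightarrow> q \<noteq> 0 \<Longrightarrow> ord_inf (to_fract p / to_fract q) =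
     int (Polynomial.degree q) - int (Polynomial.degree p)"
  unfolding ord_inf_def by (subst fract_ord_divide) (auto simp: degree_mult_eq)

lemma fract_nonzero_cases:
  assumes "c \<noteq> 0"
  obtains p q where "p \<noteq> 0" "q \<noteq> 0" "c = to_fract p / to_fract q"
  using assms by (cases c rule: Fract_cases_nonzero) (auto simp: Fract_conv_to_fract)

lemma divide_powers_eq_power_int:
  fixes t :: "'a::field"
  assumes "t \<noteq> 0"
  shows "(a / t ^ m) / (b / t ^ n) = (a / b) / t powi (int m - int n)"
proof -
  have "t powi (int m - int n) = t ^ m / t ^ n"
    using assms by (simp add: power_int_diff)
  then show ?thesis by (simp add: mult.commute)
qed

locale rational_function_extension = field_embedding \<phi>
  for \<phi> :: "'k::alg_closed_field poly fract \<Rightarrow> 'f::field"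
begin

definition pol :: "'k poly \<Rightarrow> 'f" where
  "pol p = \<phi> (to_fract p)"

lemma pol_simps:
  "pol 0 = 0" "pol 1 = 1" "pol (p + q) = pol p + pol q" "pol (p - q) = pol p - pol q"
  "pol (- p) = - pol p" "pol (p * q) = pol p * pol q"
  by (auto simp: pol_def emb_add emb_one emb_diff emb_uminus emb_mult)

lemma pol_power: "pol (p ^ n) = pol p ^ n"
  by (induction n) (auto simp: pol_simps)

lemma pol_eq_0_iff [simp]: "pol p = 0 \<longleftrightarrow> p = 0"
  by (simp add: pol_def)

lemma pol_pCons: "pol (pCons c p) = pol [:c:] + pol [:0, 1:] * pol p"
proof -
  have "pCons c p = [:c:] + [:0, 1:] * p" by simp
  then show ?thesis by (metis pol_simps(3,6))
qed

lemma const_emb_eq_pol: "const_emb \<phi> c = pol [:c:]"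
  by (simp add: pol_def ratfun_const_def)

lemma field_embedding_pol_const: "field_embedding (\<lambda>c. pol [:c:])"
proof
  fix c d :: 'k
  show "pol [:1:] = 1" by (simp add: pol_simps flip: one_pCons)
  have "[:c + d:] = [:c:] + [:d:]" "[:c * d:] = [:c:] * [:d:]" by simp_all
  then show "pol [:c + d:] = pol [:c:] + pol [:d:]" "pol [:c * d:] = pol [:c:] * pol [:d:]"
    by (simp_all only: pol_simps)
qed

lemma phi_divide: "\<phi> (to_fract p / to_fract q) = pol p / pol q"
  by (simp add: pol_def emb_divide)

lemma unit_in_const:
  assumes "valuation_ring (const_emb \<phi>) R" "c \<noteq> 0"
  shows "unit_in R (pol [:c:])"
proof -
  have *: "pol [:d:] \<in> R" for d
    using assms(1) const_emb_eq_pol by (fastforce simp: valuation_ring_def)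
  have "pol [:c:] * pol [:inverse c:] = 1"
    using assms(2) by (simp flip: pol_simps one_pCons)
  then have "inverse (pol [:c:]) = pol [:inverse c:]"
    by (rule inverse_unique)
  then show ?thesis using assms(2) * by (simp add: unit_in_def)
qed

lemma const_mem: "valuation_ring (const_emb \<phi>) R \<Longrightarrow> pol [:c:] \<in> R"
  using unit_in_const[of R c]
  by (cases "c = 0") (auto simp: unit_in_def pol_simps valuation_subring.zero_mem
      valuation_ring_imp_valuation_subring)

lemma pol_mem:
  assumes "valuation_ring (const_emb \<phi>) R" "pol [:0, 1:] \<in> R"
  shows "pol p \<in> R"
proof -
  interpret valuation_subring R
    using assms(1) by (rule valuation_ring_imp_valuation_subring)
  show ?thesis
  proof (induction p)
    case 0
    then show ?case by (simp add: zero_mem pol_simps)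
  next
    case (pCons c p)
    then show ?case
      using assms by (subst pol_pCons) (auto intro!: add_mem mult_mem const_mem)
  qed
qed

lemma pol_linear: "pol [:- \<beta>, 1:] = pol [:0, 1:] - pol [:\<beta>:]"
  by (simp flip: pol_simps)

text \<open>The place of \<open>K(x)\<close> below the place with valuation ring \<open>R\<close>.\<close>

definition over_point :: "'k \<Rightarrow> 'f set \<Rightarrow> bool" where
  "over_point \<beta> R \<longleftrightarrow> pol [:- \<beta>, 1:] \<in> nonunits R"

definition over_infinity :: "'f set \<Rightarrow> bool" where
  "over_infinity R \<longleftrightarrow> inverse (pol [:0, 1:]) \<in> nonunits R"

lemma over_infinity_iff:
  "valuation_ring (const_emb \<phi>) R \<Longrightarrow> over_infinity R \<longleftrightarrow> pol [:0, 1:] \<notin> R"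
  using valuation_subring.mem_nonunits_iff[of R "inverse (pol [:0, 1:])"]
    valuation_ring_imp_valuation_subring by (auto simp: over_infinity_def)

lemma not_over_point_and_infinity:
  assumes "valuation_ring (const_emb \<phi>) R" "over_point \<beta> R"
  shows "\<not> over_infinity R"
proof -
  interpret valuation_subring R
    using assms(1) by (rule valuation_ring_imp_valuation_subring)
  have "pol [:- \<beta>, 1:] \<in> R"
    using assms nonunits_subset by (auto simp: over_point_def)
  from add_mem[OF this const_mem[OF assms(1), of \<beta>]] have "pol [:0, 1:] \<in> R"
    by (simp add: pol_linear)
  then show ?thesis using assms by (simp add: over_infinity_iff)
qed

lemma over_point_unique:
  assumes "valuation_ring (const_emb \<phi>) R" "over_point \<beta> R" "over_point \<gamma> R"
  shows "\<beta> = \<gamma>"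
proof (rule ccontr)
  interpret valuation_subring R
    using assms(1) by (rule valuation_ring_imp_valuation_subring)
  assume "\<beta> \<noteq> \<gamma>"
  then have "unit_in R (pol [:\<gamma> - \<beta>:])" using assms by (intro unit_in_const) auto
  moreover have "pol [:\<gamma> - \<beta>:] \<in> nonunits R"
    using diff_nonunits[of "pol [:- \<beta>, 1:]" "pol [:- \<gamma>, 1:]"] assms
    by (simp add: over_point_def flip: pol_simps)
  ultimately show False by (auto simp: unit_in_def nonunits_def)
qed

text \<open>Modulo the maximal ideal, \<open>p\<close> is the constant \<open>p(\<beta>)\<close>.\<close>

lemma unit_in_pol_if_over_point:
  assumes R: "valuation_ring (const_emb \<phi>) R" "over_point \<beta> R" and p: "poly p \<beta> \<noteq> 0"
  shows "unit_in R (pol p)"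
proof -
  interpret valuation_subring R
    using assms(1) by (rule valuation_ring_imp_valuation_subring)
  have x: "pol [:0, 1:] \<in> R"
    using not_over_point_and_infinity[OF R] R by (simp add: over_infinity_iff)
  have "[:- \<beta>, 1:] dvd p - [:poly p \<beta>:]"
    by (simp add: poly_eq_0_iff_dvd[symmetric])
  then obtain q where "p - [:poly p \<beta>:] = [:- \<beta>, 1:] * q" by blast
  then have "p = [:poly p \<beta>:] + q * [:- \<beta>, 1:]" by (simp add: algebra_simps)
  from arg_cong[OF this, of pol]
  have "pol p = pol [:poly p \<beta>:] + pol q * pol [:- \<beta>, 1:]"
    by (simp only: pol_simps)
  moreover have "pol q * pol [:- \<beta>, 1:] \<in> nonunits R"
    using R(2) by (intro mult_nonunits pol_mem[OF R(1) x]) (simp add: over_point_def)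
  ultimately show ?thesis
    using unit_in_add_nonunit[OF unit_in_const[OF R(1) p]] by simp
qed

lemma unit_in_phi_at_point:
  assumes "valuation_ring (const_emb \<phi>) R" "over_point \<beta> R" "c \<noteq> 0"
  shows "unit_in R (\<phi> c / pol [:- \<beta>, 1:] powi (ord_at \<beta> c))"
proof -
  interpret valuation_subring R
    using assms(1) by (rule valuation_ring_imp_valuation_subring)
  have *: "unit_in R (pol p / pol [:- \<beta>, 1:] ^ order \<beta> p)" if p: "p \<noteq> 0" for p
  proof -
    obtain q where q: "p = [:- \<beta>, 1:] ^ order \<beta> p * q" "\<not> [:- \<beta>, 1:] dvd q"
      using order_decomp[OF p] by blast
    have "poly q \<beta> \<noteq> 0" using q(2) by (simp add: poly_eq_0_iff_dvd)
    moreover have "pol p = pol [:- \<beta>, 1:] ^ order \<beta> p * pol q"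
      using arg_cong[OF q(1), of pol] by (simp only: pol_simps pol_power)
    ultimately show ?thesis
      using unit_in_pol_if_over_point[OF assms(1,2)] by simp
  qed
  obtain p q where pq: "p \<noteq> 0" "q \<noteq> 0" "c = to_fract p / to_fract q"
    using assms(3) by (rule fract_nonzero_cases)
  have "unit_in R ((pol p / pol [:- \<beta>, 1:] ^ order \<beta> p) / (pol q / pol [:- \<beta>, 1:] ^ order \<beta> q))"
    by (intro unit_in_divide * pq)
  then show ?thesis
    unfolding pq(3) ord_at_divide[OF pq(1,2)] phi_divide
    by (subst (asm) divide_powers_eq_power_int) auto
qed

text \<open>Modulo the maximal ideal, \<open>p / x\<^sup>d\<close> with \<open>d = deg p\<close> is the leading coefficient of \<open>p\<close>.\<close>

lemma unit_in_phi_at_infinity: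
  assumes "valuation_ring (const_emb \<phi>) R" "over_infinity R" "c \<noteq> 0"
  shows "unit_in R (\<phi> c / inverse (pol [:0, 1:]) powi (ord_inf c))"
proof -
  interpret valuation_subring R
    using assms(1) by (rule valuation_ring_imp_valuation_subring)
  define x where "x = pol [:0, 1:]"
  have x: "x \<noteq> 0" "inverse x \<in> nonunits R"
    using assms(2) by (auto simp: x_def over_infinity_def)
  have *: "p \<noteq> 0 \<Longrightarrow> unit_in R (pol p / x ^ Polynomial.degree p)" for p
  proof (induction p)
    case (pCons a p)
    show ?case
    proof (cases "p = 0")
      case True
      then show ?thesis
        using unit_in_const[OF assms(1), of a] pCons.prems by simp
    next
      case False
      have "pol [:a:] * inverse x ^ Suc (Polynomial.degree p) \<in> nonunits R"
        by (rule mult_nonunits[OF power_nonunits[OF x(2)] const_mem[OF assms(1)]]) simp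
      then have "unit_in R (pol p / x ^ Polynomial.degree p +
          pol [:a:] * inverse x ^ Suc (Polynomial.degree p))"
        by (rule unit_in_add_nonunit[OF pCons.IH[OF False]])
      also have "pol p / x ^ Polynomial.degree p + pol [:a:] * inverse x ^ Suc (Polynomial.degree p) =
          (pol [:a:] + x * pol p) / x ^ Suc (Polynomial.degree p)"
        using x(1) by (simp add: field_simps)
      also have "\<dots> = pol (pCons a p) / x ^ Polynomial.degree (pCons a p)"
        using False by (simp add: pol_pCons[of a p] x_def)
      finally show ?thesis .
    qed
  qed simp
  obtain p q where pq: "p \<noteq> 0" "q \<noteq> 0" "c = to_fract p / to_fract q"
    using assms(3) by (rule fract_nonzero_cases)
  have "unit_in R ((pol p / x ^ Polynomial.degree p) / (pol q / x ^ Polynomial.degree q))"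
    by (rule unit_in_divide[OF *[OF pq(1)] *[OF pq(2)]])
  also have "(pol p / x ^ Polynomial.degree p) / (pol q / x ^ Polynomial.degree q) =
      \<phi> c / x powi (- ord_inf c)"
    unfolding pq(3) ord_inf_divide[OF pq(1,2)] phi_divide minus_diff_eq
    by (rule divide_powers_eq_power_int) (rule x(1))
  also have "x powi (- ord_inf c) = inverse x powi (ord_inf c)"
    unfolding power_int_minus power_int_inverse ..
  finally show ?thesis unfolding x_def .
qed

end

text \<open>
  That \<open>F\<close> is algebraic over \<open>K(x)\<close> of bounded degree is what makes all places discrete: in a
  relation \<open>\<Sum> c\<^sub>i h\<^sup>i = 0\<close> two terms have the same value, so some power of \<open>h\<close> with exponent at
  most \<open>N\<close> has the value of a rational function.
\<close>

locale bounded_algebraic_extension = rational_function_extension \<phi>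
  for \<phi> :: "'k::alg_closed_field poly fract \<Rightarrow> 'f::field" +
  fixes N :: nat
  assumes algebraic: "\<exists>c. (\<exists>i\<le>N. c i \<noteq> 0) \<and> (\<Sum>i\<le>N. \<phi> (c i) * h ^ i) = 0"
begin

lemma ex_power_associated_rational:
  assumes "valuation_subring R" "h \<noteq> 0"
  shows "\<exists>n\<in>{1..N}. \<exists>c. c \<noteq> 0 \<and> unit_in R (h ^ n / \<phi> c)"
proof -
  interpret valuation_subring R by fact
  obtain c k where c: "k \<le> N" "c k \<noteq> 0" "(\<Sum>i\<le>N. \<phi> (c i) * h ^ i) = 0"
    using algebraic by blast
  have "\<exists>i\<in>{..N}. \<exists>j\<in>{..N}. i \<noteq> j \<and> \<phi> (c i) * h ^ i \<noteq> 0 \<and> \<phi> (c j) * h ^ j \<noteq> 0 \<and>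
      unit_in R ((\<phi> (c i) * h ^ i) / (\<phi> (c j) * h ^ j))"
    by (rule vanishing_sum_has_associated_terms[of "{..N}" "\<lambda>i. \<phi> (c i) * h ^ i" k])
      (use c assms in auto)
  then obtain i j where ij: "i \<le> N" "j \<le> N" "i \<noteq> j" "c i \<noteq> 0" "c j \<noteq> 0"
    "unit_in R ((\<phi> (c i) * h ^ i) / (\<phi> (c j) * h ^ j))" by auto
  have *: ?thesis if "i \<le> N" "j < i" "c i \<noteq> 0" "c j \<noteq> 0"
    "unit_in R ((\<phi> (c i) * h ^ i) / (\<phi> (c j) * h ^ j))" for i j
  proof -
    have "(\<phi> (c i) * h ^ i) / (\<phi> (c j) * h ^ j) = h ^ (i - j) / \<phi> (c j / c i)"
      using that assms(2) by (simp add: emb_divide power_diff field_simps)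
    moreover have "i - j \<in> {1..N}" "c j / c i \<noteq> 0" using that by auto
    ultimately show ?thesis using that by metis
  qed
  consider "j < i" | "i < j" using ij by linarith
  then show ?thesis
  proof cases
    case 1
    then show ?thesis using *[of i j] ij by blast
  next
    case 2
    have "unit_in R ((\<phi> (c j) * h ^ j) / (\<phi> (c i) * h ^ i))"
      using unit_in_inverse[OF ij(6)] by simp
    then show ?thesis using *[of j i] ij 2 by blast
  qed
qed

lemma ex_discrete_valuation:
  assumes R: "valuation_ring (const_emb \<phi>) R" and \<tau>: "\<tau> \<in> nonunits R" "\<tau> \<noteq> 0"
    and ord: "\<And>c. c \<noteq> 0 \<Longrightarrow> unit_in R (\<phi> c / \<tau> powi (ord c))"
  shows "\<exists>w. discrete_valuation R w \<and>
    (\<exists>e\<in>{1..int N}. \<forall>c. c \<noteq> 0 \<longrightarrow> w (\<phi> c) = e * ord c)"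
proof -
  interpret valuation_subring R
    using R by (rule valuation_ring_imp_valuation_subring)
  have "\<exists>n\<in>{1..N}. \<exists>k. unit_in R (h ^ n / \<tau> powi k)" if h: "h \<noteq> 0" for h
  proof -
    obtain n c where nc: "n \<in> {1..N}" "c \<noteq> 0" "unit_in R (h ^ n / \<phi> c)"
      using ex_power_associated_rational[OF valuation_subring_axioms h] by blast
    then have "unit_in R ((h ^ n / \<phi> c) * (\<phi> c / \<tau> powi (ord c)))"
      by (intro unit_in_mult ord)
    then show ?thesis using nc by auto
  qed
  from discrete_valuation_if_bounded_index[OF \<tau> this] obtain w
    where w: "discrete_valuation R w" "w \<tau> \<in> {1..int N}" by blast
  interpret discrete_valuation R w by fact
  have "w (\<phi> c) = w \<tau> * ord c" if "c \<noteq> 0" for c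
    using ord[OF that] that \<tau> by (simp add: unit_in_iff_w w_divide w_power_int)
  then show ?thesis using w by blast
qed

lemma ex_valuation_at_point:
  assumes "valuation_ring (const_emb \<phi>) R" "over_point \<beta> R"
  shows "\<exists>w. discrete_valuation R w \<and>
    (\<exists>e\<in>{1..int N}. \<forall>c. c \<noteq> 0 \<longrightarrow> w (\<phi> c) = e * ord_at \<beta> c)"
  using assms unit_in_phi_at_point
  by (intro ex_discrete_valuation[where \<tau> = "pol [:- \<beta>, 1:]"]) (auto simp: over_point_def)

lemma ex_valuation_at_infinity:
  assumes "valuation_ring (const_emb \<phi>) R" "over_infinity R"
  shows "\<exists>w. discrete_valuation R w \<and>
    (\<exists>e\<in>{1..int N}. \<forall>c. c \<noteq> 0 \<longrightarrow> w (\<phi> c) = e * ord_inf c)"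
  using assms unit_in_phi_at_infinity
  by (intro ex_discrete_valuation[where \<tau> = "inverse (pol [:0, 1:])"])
    (auto simp: over_infinity_def)

text \<open>
  A valuation ring containing \<open>x\<close> has a polynomial among its nonunits, since otherwise it would
  contain \<open>K(x)\<close> and all of \<open>F\<close>; as \<open>K\<close> is algebraically closed, it has a linear one.
\<close>

lemma over_infinity_or_point:
  assumes R: "valuation_ring (const_emb \<phi>) R"
  shows "over_infinity R \<or> (\<exists>\<beta>. over_point \<beta> R)"
proof (rule disjCI)
  interpret valuation_subring R
    using R by (rule valuation_ring_imp_valuation_subring)
  assume no: "\<nexists>\<beta>. over_point \<beta> R"
  show "over_infinity R"
  proof (rule ccontr)
    assume "\<not> over_infinity R"
    then have x: "pol [:0, 1:] \<in> R" using R by (simp add: over_infinity_iff)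
    have unit: "unit_in R (pol p)" if "p \<noteq> 0" for p
      using that
    proof (induction "Polynomial.degree p" arbitrary: p)
      case 0
      then obtain c where "p = [:c:]" "c \<noteq> 0" by (metis degree_eq_zeroE pCons_0_0)
      then show ?case using R by (simp add: unit_in_const)
    next
      case (Suc n)
      then obtain \<beta> where "poly p \<beta> = 0"
        using alg_closed_imp_poly_has_root[of p] by auto
      then obtain q where q: "p = [:- \<beta>, 1:] * q" by (auto simp: poly_eq_0_iff_dvd)
      with Suc have "q \<noteq> 0" "Polynomial.degree q = n"
        by (auto simp: degree_mult_eq simp del: mult_pCons_left)
      then have "unit_in R (pol q)" using Suc by auto
      moreover have "unit_in R (pol [:- \<beta>, 1:])"
        using no pol_mem[OF R x] by (simp add: unit_in_iff over_point_def)
      ultimately show ?case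
        unfolding q pol_simps(6) by (intro unit_in_mult)
    qed
    have unit': "unit_in R (\<phi> c)" if "c \<noteq> 0" for c
      using that by (rule fract_nonzero_cases) (auto simp: phi_divide intro!: unit_in_divide unit)
    have "h \<in> R" for h
    proof (cases "h = 0")
      case True
      then show ?thesis by (simp add: zero_mem)
    next
      case False
      then obtain n c where nc: "n \<in> {1..N}" "c \<noteq> 0" "unit_in R (h ^ n / \<phi> c)"
        using ex_power_associated_rational[OF valuation_subring_axioms] by blast
      then have "unit_in R ((h ^ n / \<phi> c) * \<phi> c)"
        using unit' by (intro unit_in_mult)
      then show ?thesis
        using nc mem_if_power_mem[of h n] by (simp add: unit_in_def)
    qed
    then show False using R by (auto simp: valuation_ring_def)
  qed
qed

lemma ex_valuation:
  assumes "valuation_ring (const_emb \<phi>) R"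
  shows "\<exists>w. discrete_valuation R w"
  using over_infinity_or_point[OF assms] ex_valuation_at_point[OF assms]
    ex_valuation_at_infinity[OF assms] by blast

lemma valuation_nonneg_iff:
  assumes "valuation_ring (const_emb \<phi>) R" "z \<noteq> 0"
  shows "valuation (const_emb \<phi>) (nonunits R) z \<ge> 0 \<longleftrightarrow> z \<in> R"
proof -
  obtain w where w: "discrete_valuation R w"
    using ex_valuation[OF assms(1)] by blast
  then show ?thesis
    using assms by (simp add: valuation_nonunits discrete_valuation.mem_iff)
qed

end

lemma bounded_algebraic_extension_id:
  "bounded_algebraic_extension (id :: 'k::alg_closed_field poly fract \<Rightarrow> _) 1"
proof unfold_locales
  fix h :: "'k poly fract"
  show "\<exists>c. (\<exists>i\<le>1::nat. c i \<noteq> 0) \<and> (\<Sum>i\<le>1. id (c i) * h ^ i) = 0"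
    by (rule exI[of _ "\<lambda>i. if i = 0 then h else - 1"]) auto
qed auto


section \<open>Existence of places\<close>

definition subring_set :: "'f::field set \<Rightarrow> bool" where
  "subring_set A \<longleftrightarrow> 1 \<in> A \<and> (\<forall>a\<in>A. \<forall>b\<in>A. a - b \<in> A \<and> a * b \<in> A)"

lemma subring_setD:
  assumes "subring_set A"
  shows "1 \<in> A" "0 \<in> A" "a \<in> A \<Longrightarrow> b \<in> A \<Longrightarrow> a - b \<in> A" "a \<in> A \<Longrightarrow> b \<in> A \<Longrightarrow> a * b \<in> A"
    "a \<in> A \<Longrightarrow> b \<in> A \<Longrightarrow> a + b \<in> A"
proof -
  show *: "1 \<in> A" "a \<in> A \<Longrightarrow> b \<in> A \<Longrightarrow> a - b \<in> A" "a \<in> A \<Longrightarrow> b \<in> A \<Longrightarrow> a * b \<in> A" for a b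
    using assms by (auto simp: subring_set_def)
  show zero: "0 \<in> A" using *(2)[of 1 1] *(1) by simp
  show "a \<in> A \<Longrightarrow> b \<in> A \<Longrightarrow> a + b \<in> A"
    using *(2)[of a "0 - b"] *(2)[of 0 b] zero by simp
qed

lemma subring_set_sum:
  assumes "subring_set A" "\<And>i. i \<in> I \<Longrightarrow> h i \<in> A"
  shows "sum h I \<in> A"
  using assms(2)
  by (induction I rule: infinite_finite_induct) (auto intro: subring_setD[OF assms(1)])

lemma subring_set_power: "subring_set A \<Longrightarrow> a \<in> A \<Longrightarrow> a ^ n \<in> A"
  by (induction n) (auto intro: subring_setD)

definition adjoin_element :: "'f::field set \<Rightarrow> 'f \<Rightarrow> 'f set" where
  "adjoin_element A w = {poly p w | p. \<forall>i. coeff p i \<in> A}"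

lemma subring_set_adjoin_element:
  assumes "subring_set A"
  shows "subring_set (adjoin_element A w)"
  unfolding subring_set_def
proof (intro conjI ballI)
  have "\<forall>i. coeff 1 i \<in> A"
    using subring_setD(1,2)[OF assms] by (simp add: coeff_1)
  moreover have "1 = poly 1 w" by simp
  ultimately show "1 \<in> adjoin_element A w"
    unfolding adjoin_element_def by blast
  fix a b
  assume "a \<in> adjoin_element A w" "b \<in> adjoin_element A w"
  then obtain p q where pq: "a = poly p w" "b = poly q w" "\<And>i. coeff p i \<in> A" "\<And>i. coeff q i \<in> A"
    by (auto simp: adjoin_element_def)
  have "\<forall>i. coeff (p - q) i \<in> A"
    using pq(3,4) subring_setD(3)[OF assms] by simp
  moreover have "a - b = poly (p - q) w" using pq(1,2) by simp
  ultimately show "a - b \<in> adjoin_element A w"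
    unfolding adjoin_element_def by blast
  have "\<forall>i. coeff (p * q) i \<in> A"
    unfolding coeff_mult using pq(3,4)
    by (intro allI subring_set_sum[OF assms] subring_setD(4)[OF assms])
  moreover have "a * b = poly (p * q) w" using pq(1,2) by simp
  ultimately show "a * b \<in> adjoin_element A w"
    unfolding adjoin_element_def by blast
qed

lemma subset_adjoin_element:
  assumes "subring_set A"
  shows "A \<subseteq> adjoin_element A w"
proof
  fix a
  assume "a \<in> A"
  then have "\<forall>i. coeff [:a:] i \<in> A"
    using subring_setD(2)[OF assms] by (auto simp: coeff_pCons split: nat.splits)
  moreover have "a = poly [:a:] w" by simp
  ultimately show "a \<in> adjoin_element A w" unfolding adjoin_element_def by blast
qed

lemma mem_adjoin_element:
  assumes "subring_set A"
  shows "w \<in> adjoin_element A w"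
proof -
  have "\<forall>i. coeff [:0, 1:] i \<in> A"
    using subring_setD[OF assms] by (auto simp: coeff_pCons split: nat.splits)
  moreover have "w = poly [:0, 1:] w" by simp
  ultimately show ?thesis unfolding adjoin_element_def by blast
qed

text \<open>
  The step behind Chevalley's extension theorem: if \<open>1 / \<tau>\<close> is a polynomial in \<open>w\<close> of degree
  \<open>n\<close> and a polynomial in \<open>1 / w\<close> of degree at most \<open>n\<close>, the second relation expresses \<open>w\<^sup>n\<close> by
  smaller powers of \<open>w\<close>, which lowers the degree of the first.
\<close>

lemma lower_degree_of_relation:
  fixes \<tau> w :: "'f::field"
  assumes A: "subring_set A" "\<tau> \<in> A" "\<tau> \<noteq> 0" "w \<noteq> 0"
    and unit: "\<And>c. c \<in> A \<Longrightarrow> 1 - \<tau> * c \<noteq> 0 \<and> inverse (1 - \<tau> * c) \<in> A"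
    and p: "inverse \<tau> = poly p w" "\<And>i. coeff p i \<in> A"
    and q: "inverse \<tau> = poly q (inverse w)" "\<And>i. coeff q i \<in> A"
    and deg: "Polynomial.degree q \<le> Polynomial.degree p"
  shows "\<exists>p'. inverse \<tau> = poly p' w \<and> (\<forall>i. coeff p' i \<in> A) \<and>
    Polynomial.degree p' < Polynomial.degree p"
proof -
  define n where "n = Polynomial.degree p"
  define u where "u = 1 - \<tau> * coeff q 0"
  have u: "u \<noteq> 0" "inverse u \<in> A" using unit[OF q(2)] by (auto simp: u_def)
  define S where "S = (\<Sum>j<n. coeff q (n - j) * w ^ j)"
  have "inverse \<tau> = (\<Sum>i\<le>n. coeff q i * inverse w ^ i)"
    unfolding q(1) poly_altdef
    using deg by (intro sum.mono_neutral_left) (auto simp: n_def coeff_eq_0)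
  then have "w ^ n * inverse \<tau> = (\<Sum>i\<le>n. coeff q i * w ^ (n - i))"
    using A(4) by (auto simp: sum_distrib_left power_diff power_inverse field_simps intro!: sum.cong)
  also have "\<dots> = (\<Sum>j\<le>n. coeff q (n - j) * w ^ j)"
    by (rule sum.reindex_bij_witness[of _ "\<lambda>j. n - j" "\<lambda>j. n - j"]) auto
  also have "\<dots> = S + coeff q 0 * w ^ n"
    by (simp add: S_def flip: lessThan_Suc_atMost)
  finally have "w ^ n * u = \<tau> * S"
    using A(3) by (simp add: u_def field_simps)
  then have wn: "w ^ n = inverse u * \<tau> * S"
    using u by (simp add: field_simps)
  define p' where "p' = (\<Sum>j<n. monom (coeff p j + coeff p n * inverse u * \<tau> * coeff q (n - j)) j)"
  have "inverse \<tau> = (\<Sum>j\<le>n. coeff p j * w ^ j)"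
    unfolding p(1) poly_altdef by (simp add: n_def)
  also have "\<dots> = (\<Sum>j<n. coeff p j * w ^ j) + coeff p n * (inverse u * \<tau> * S)"
    by (simp add: wn flip: lessThan_Suc_atMost)
  also have "\<dots> = poly p' w"
    by (simp add: p'_def S_def poly_sum poly_monom sum_distrib_left sum.distrib algebra_simps)
  finally have eq: "inverse \<tau> = poly p' w" .
  have coeff_p': "coeff p' i = (if i < n then coeff p i + coeff p n * inverse u * \<tau> * coeff q (n - i) else 0)" for i
    by (auto simp: p'_def coeff_sum)
  have "n \<noteq> 0"
  proof
    assume "n = 0"
    then have "inverse \<tau> = 0" using eq by (simp add: p'_def)
    then show False using A(3) by simp
  qed
  moreover have "Polynomial.degree p' \<le> n - 1"
    by (intro degree_le) (auto simp: coeff_p')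
  ultimately have "Polynomial.degree p' < n" by linarith
  moreover have "\<forall>i. coeff p' i \<in> A"
    using A(2) p(2) q(2) u(2) by (auto simp: coeff_p' intro!: subring_setD[OF A(1)])
  ultimately show ?thesis using eq by (auto simp: n_def)
qed

text \<open>
  A subring that is maximal among those avoiding \<open>1 / \<tau>\<close> is a valuation ring (Chevalley).
\<close>

lemma ex_valuation_subring_avoiding:
  fixes \<tau> :: "'f::field"
  assumes A0: "subring_set A0" "\<tau> \<in> A0" "inverse \<tau> \<notin> A0"
  shows "\<exists>R. valuation_subring R \<and> A0 \<subseteq> R \<and> inverse \<tau> \<notin> R"
proof -
  define \<A> where "\<A> = {A. subring_set A \<and> A0 \<subseteq> A \<and> inverse \<tau> \<notin> A}"
  have "\<exists>M\<in>\<A>. \<forall>B\<in>\<A>. M \<subseteq> B \<longrightarrow> B = M"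
  proof (rule subset_Zorn_nonempty)
    show "\<A> \<noteq> {}" using A0 by (auto simp: \<A>_def)
    fix \<C>
    assume C: "\<C> \<noteq> {}" "subset.chain \<A> \<C>"
    have sub: "subring_set B" "A0 \<subseteq> B" "inverse \<tau> \<notin> B" if "B \<in> \<C>" for B
      using that C by (auto simp: \<A>_def subset.chain_def)
    have "a - b \<in> \<Union>\<C> \<and> a * b \<in> \<Union>\<C>" if ab: "a \<in> \<Union>\<C>" "b \<in> \<Union>\<C>" for a b
    proof -
      from ab obtain B1 B2 where B: "a \<in> B1" "b \<in> B2" "B1 \<in> \<C>" "B2 \<in> \<C>" by blast
      then have "B1 \<subseteq> B2 \<or> B2 \<subseteq> B1"
        using C(2) unfolding subset.chain_def by blast
      then obtain B where "B \<in> \<C>" "a \<in> B" "b \<in> B" using B by blast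
      then show ?thesis using subring_setD[OF sub(1)[of B]] by blast
    qed
    moreover have "A0 \<subseteq> \<Union>\<C>" using C(1) sub(2) by blast
    moreover have "1 \<in> \<Union>\<C>" using C(1) subring_setD(1)[OF sub(1)] by blast
    moreover have "inverse \<tau> \<notin> \<Union>\<C>" using sub(3) by blast
    ultimately show "\<Union>\<C> \<in> \<A>" by (simp add: \<A>_def subring_set_def)
  qed
  then obtain A where A: "subring_set A" "A0 \<subseteq> A" "inverse \<tau> \<notin> A"
    and max: "\<And>B. B \<in> \<A> \<Longrightarrow> A \<subseteq> B \<Longrightarrow> B = A" by (auto simp: \<A>_def)
  have \<tau>: "\<tau> \<in> A" "\<tau> \<noteq> 0" using A0 A subring_setD(2)[OF A(1)] by auto
  have adjoin: "inverse \<tau> \<in> adjoin_element A w" if "w \<notin> A" for w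
  proof (rule ccontr)
    assume "inverse \<tau> \<notin> adjoin_element A w"
    then have "adjoin_element A w \<in> \<A>"
      using A subring_set_adjoin_element subset_adjoin_element by (fastforce simp: \<A>_def)
    then show False
      using max[of "adjoin_element A w"] mem_adjoin_element[OF A(1)] subset_adjoin_element[OF A(1)] that
      by blast
  qed
  have unit: "1 - \<tau> * c \<noteq> 0 \<and> inverse (1 - \<tau> * c) \<in> A" if c: "c \<in> A" for c
  proof
    define u where "u = 1 - \<tau> * c"
    show u0: "1 - \<tau> * c \<noteq> 0"
    proof
      assume "1 - \<tau> * c = 0"
      then have "inverse \<tau> = c" by (intro inverse_unique) simp
      then show False using c A(3) by simp
    qed
    have uA: "u \<in> A" using c \<tau> by (auto simp: u_def intro!: subring_setD[OF A(1)])
    show "inverse (1 - \<tau> * c) \<in> A"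
    proof (rule ccontr)
      assume "inverse (1 - \<tau> * c) \<notin> A"
      from adjoin[OF this] obtain g
        where g: "inverse \<tau> = poly g (inverse u)" "\<And>i. coeff g i \<in> A"
        by (auto simp: adjoin_element_def u_def)
      define d where "d = Polynomial.degree g"
      have "u ^ d * inverse \<tau> = (\<Sum>i\<le>d. coeff g i * u ^ (d - i))"
        unfolding g(1) poly_altdef using u0
        by (auto simp: sum_distrib_left power_diff power_inverse field_simps d_def u_def intro!: sum.cong)
      also have "\<dots> \<in> A"
        using g(2) uA by (intro subring_set_sum subring_setD(4) subring_set_power A(1))
      finally have 1: "u ^ d * inverse \<tau> \<in> A" .
      have "\<exists>b\<in>A. u ^ k = 1 - \<tau> * b" for k
      proof (induction k)
        case 0
        show ?case using subring_setD(2)[OF A(1)] by force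
      next
        case (Suc k)
        then obtain b where b: "b \<in> A" "u ^ k = 1 - \<tau> * b" by blast
        have "c * u ^ k + b \<in> A" "u ^ Suc k = 1 - \<tau> * (c * u ^ k + b)"
          using c uA b by (auto simp: u_def algebra_simps intro!: subring_setD[OF A(1)] subring_set_power[OF A(1)])
        then show ?case by blast
      qed
      then obtain b where b: "b \<in> A" "u ^ d = 1 - \<tau> * b" by blast
      have "u ^ d * inverse \<tau> + b \<in> A" using 1 b(1) by (rule subring_setD[OF A(1)])
      also have "u ^ d * inverse \<tau> + b = inverse \<tau>"
        using \<tau> b(2) by (simp add: field_simps)
      finally show False using A(3) by simp
    qed
  qed
  have "w \<in> A \<or> inverse w \<in> A" for w
  proof (rule ccontr)
    assume not: "\<not> (w \<in> A \<or> inverse w \<in> A)"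
    then have w0: "w \<noteq> 0" using subring_setD(2)[OF A(1)] by auto
    define P where "P v p \<longleftrightarrow> inverse \<tau> = poly p v \<and> (\<forall>i. coeff p i \<in> A)" for v p
    define n where "n v = (LEAST d. \<exists>p. P v p \<and> Polynomial.degree p = d)" for v
    have ex: "\<exists>p. P v p \<and> Polynomial.degree p = n v" if "v \<notin> A" for v
    proof -
      from adjoin[OF that] obtain p where "P v p" by (auto simp: adjoin_element_def P_def)
      then have "\<exists>d p. P v p \<and> Polynomial.degree p = d" by blast
      from LeastI_ex[OF this] show ?thesis unfolding n_def .
    qed
    have le: "n v \<le> Polynomial.degree p" if "P v p" for v p
      unfolding n_def by (rule Least_le) (use that in blast)
    have False if v: "v \<notin> A" "inverse v \<notin> A" "v \<noteq> 0" "n (inverse v) \<le> n v" for v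
    proof -
      obtain p where p: "P v p" "Polynomial.degree p = n v" using ex[OF v(1)] by blast
      obtain q where q: "P (inverse v) q" "Polynomial.degree q = n (inverse v)"
        using ex[OF v(2)] by blast
      have "\<exists>p'. inverse \<tau> = poly p' v \<and> (\<forall>i. coeff p' i \<in> A) \<and>
          Polynomial.degree p' < Polynomial.degree p"
        by (rule lower_degree_of_relation[OF A(1) \<tau> v(3) unit, of p q])
          (use p q v in \<open>auto simp: P_def\<close>)
      then obtain p' where "P v p'" "Polynomial.degree p' < n v" using p(2) by (auto simp: P_def)
      then show False using le[of v p'] by simp
    qed
    from this[of w] this[of "inverse w"] show False using not w0 by (cases "n w \<le> n (inverse w)") auto
  qed
  then have "valuation_subring A"
    using subring_setD[OF A(1)] by unfold_locales auto
  then show ?thesis using A by blast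
qed

lemma (in rational_function_extension) ex_valuation_ring_over_point:
  "\<exists>R. valuation_ring (const_emb \<phi>) R \<and> over_point \<beta> R"
proof -
  have pol_inj: "p = q" if "pol p = pol q" for p q
    using that pol_eq_0_iff[of "p - q"] by (simp add: pol_simps)
  have sub: "subring_set (range pol)"
    unfolding subring_set_def
  proof (intro conjI ballI)
    show "1 \<in> range pol" by (rule range_eqI[of _ _ 1]) (simp add: pol_simps)
    fix a b
    assume "a \<in> range pol" "b \<in> range pol"
    then obtain p q where "a = pol p" "b = pol q" by blast
    then show "a - b \<in> range pol" "a * b \<in> range pol"
      by (auto simp flip: pol_simps)
  qed
  have not_inv: "inverse (pol [:- \<beta>, 1:]) \<notin> range pol"
  proof
    assume "inverse (pol [:- \<beta>, 1:]) \<in> range pol"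
    then obtain p where p: "pol p = inverse (pol [:- \<beta>, 1:])" by force
    have "pol [:- \<beta>, 1:] \<noteq> 0" by simp
    then have "pol ([:- \<beta>, 1:] * p) = pol 1"
      unfolding pol_simps(6) p by (simp add: pol_simps(2))
    then have "[:- \<beta>, 1:] * p = 1" by (rule pol_inj)
    then have "poly ([:- \<beta>, 1:] * p) \<beta> = 1" by simp
    then show False by simp
  qed
  from ex_valuation_subring_avoiding[OF sub rangeI not_inv] obtain R
    where R: "valuation_subring R" "range pol \<subseteq> R" "inverse (pol [:- \<beta>, 1:]) \<notin> R" by blast
  interpret valuation_subring R by fact
  have "range (const_emb \<phi>) \<subset> R"
  proof
    have range: "range (const_emb \<phi>) = range (\<lambda>c. pol [:c:])"
      by (rule arg_cong[where f = range], rule ext, rule const_emb_eq_pol)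
    show "range (const_emb \<phi>) \<subseteq> R" unfolding range using R(2) by blast
    have "pol [:0, 1:] \<notin> range (const_emb \<phi>)"
      unfolding range using pol_inj by fastforce
    then show "range (const_emb \<phi>) \<noteq> R" using R(2) by blast
  qed
  then have "valuation_ring (const_emb \<phi>) R"
    unfolding valuation_ring_def using R(3) one_mem diff_mem mult_mem mem_or_inverse_mem by blast
  moreover have "over_point \<beta> R"
    unfolding over_point_def using R(3) by (simp add: mem_nonunits_iff)
  ultimately show ?thesis by blast
qed


section \<open>Roots of unity\<close>

lemma card_roots_if_rsquarefree:
  fixes p :: "'k::alg_closed_field poly"
  assumes "rsquarefree p"
  shows "card {a. poly p a = 0} = Polynomial.degree p"
  using assms
proof (induction "Polynomial.degree p" arbitrary: p)
  case 0
  then have "p \<noteq> 0" by (auto simp: rsquarefree_def)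
  moreover obtain c where "p = [:c:]" using 0 by (metis degree_eq_zeroE)
  ultimately show ?case using 0 by simp
next
  case (Suc n)
  then obtain a where "poly p a = 0"
    using alg_closed_imp_poly_has_root[of p] by auto
  then obtain q where q: "p = [:- a, 1:] * q" by (auto simp: poly_eq_0_iff_dvd)
  have "p \<noteq> 0" and ord: "order b p \<le> 1" for b
    using Suc.prems by (auto simp: rsquarefree_def le_Suc_eq)
  then have "q \<noteq> 0" using q by auto
  have ord_q: "order b p = order b [:- a, 1:] + order b q" for b
    using \<open>p \<noteq> 0\<close> unfolding q by (intro order_mult) simp
  have "rsquarefree q"
    unfolding rsquarefree_def
  proof (intro conjI allI)
    show "order b q = 0 \<or> order b q = 1" for b
      using ord[of b] ord_q[of b] by linarith
  qed (rule \<open>q \<noteq> 0\<close>)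
  moreover have "order a q = 0"
    using ord[of a] ord_q[of a] order_power_n_n[of a 1] by simp
  then have "poly q a \<noteq> 0" using \<open>q \<noteq> 0\<close> by (simp add: order_root)
  moreover have "Polynomial.degree q = n"
    using Suc(2) \<open>q \<noteq> 0\<close> unfolding q by (simp add: degree_mult_eq del: mult_pCons_left)
  ultimately have "card {b. poly q b = 0} = n" "a \<notin> {b. poly q b = 0}"
    using Suc(1) by auto
  moreover have "{b. poly p b = 0} = insert a {b. poly q b = 0}"
    unfolding q by auto
  ultimately show ?case
    using Suc(2) \<open>q \<noteq> 0\<close> by (simp add: poly_roots_finite)
qed

lemma card_roots_of_unity_le:
  assumes "n > 0"
  shows "finite {a::'k::field. a ^ n = 1} \<and> card {a::'k. a ^ n = 1} \<le> n"
proof -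
  let ?p = "monom 1 n - 1 :: 'k poly"
  have eq: "{a. a ^ n = 1} = {a. poly ?p a = 0}" by (auto simp: poly_monom)
  have "coeff ?p n = 1" using assms by simp
  then have "?p \<noteq> 0" by (metis coeff_0 one_neq_zero)
  moreover have "Polynomial.degree ?p \<le> n"
    by (intro degree_diff_le) (auto simp: degree_monom_eq)
  ultimately show ?thesis
    unfolding eq using card_poly_roots_bound[of ?p] poly_roots_finite[of ?p] by linarith
qed

lemma card_roots_of_unity:
  assumes "of_nat n \<noteq> (0 :: 'k::alg_closed_field)"
  shows "card {a::'k. a ^ n = 1} = n"
proof -
  have "n > 0" using assms by (cases n) auto
  let ?p = "monom 1 n - 1 :: 'k poly"
  have eq: "{a. a ^ n = 1} = {a. poly ?p a = 0}" by (auto simp: poly_monom)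
  have deg: "Polynomial.degree ?p = n"
    using degree_add_eq_left[of "- 1 :: 'k poly" "monom 1 n"] \<open>n > 0\<close>
    by (simp add: degree_monom_eq)
  have "order a ?p \<le> 1" for a
  proof (rule ccontr)
    assume "\<not> order a ?p \<le> 1"
    then have "[:- a, 1:] ^ 2 dvd ?p" by (simp add: order_divides)
    then obtain q where q: "?p = [:- a, 1:] ^ 2 * q" by blast
    define l where "l = [:- a, 1:]"
    have "poly l a = 0" by (simp add: l_def)
    then have "poly ?p a = 0" "poly (pderiv ?p) a = 0"
      unfolding q power2_eq_square l_def[symmetric] by (simp_all add: pderiv_mult)
    then have a: "a ^ n = 1" "of_nat n * a ^ (n - 1) = 0"
      by (auto simp: poly_monom pderiv_diff pderiv_monom)
    from a(2) assms have "a = 0" by auto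
    with a(1) \<open>n > 0\<close> show False by (simp add: power_0_left)
  qed
  moreover have "?p \<noteq> 0" using deg \<open>n > 0\<close> by fastforce
  ultimately have "rsquarefree ?p" by (auto simp: rsquarefree_def le_Suc_eq)
  from card_roots_if_rsquarefree[OF this] show ?thesis unfolding eq deg .
qed

text \<open>
  If \<open>n\<close> does not divide \<open>j\<close>, some root of unity \<open>\<eta>\<close> has \<open>\<eta>\<^sup>j \<noteq> 1\<close>; multiplication by \<open>\<eta>\<close> permutes
  the summands and multiplies the sum by \<open>\<eta>\<^sup>j\<close>.
\<close>

lemma sum_powers_roots_of_unity:
  assumes "of_nat n \<noteq> (0 :: 'k::alg_closed_field)"
  shows "(\<Sum>\<zeta> | \<zeta> ^ n = 1. \<zeta> ^ j) = (if n dvd j then of_nat n else (0 :: 'k))"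
proof (cases "n dvd j")
  case True
  then obtain i where "j = n * i" by blast
  then have "(\<Sum>\<zeta> | \<zeta> ^ n = (1::'k). \<zeta> ^ j) = (\<Sum>\<zeta> | \<zeta> ^ n = (1::'k). 1)"
    by (intro sum.cong) (auto simp: power_mult)
  then show ?thesis using True card_roots_of_unity[OF assms] by simp
next
  case False
  have "n > 0" using assms by (cases n) auto
  define U where "U = {\<zeta>::'k. \<zeta> ^ n = 1}"
  define k where "k = j mod n"
  have k: "0 < k" "k < n" using False \<open>n > 0\<close> by (auto simp: k_def dvd_eq_mod_eq_0)
  have "\<not> U \<subseteq> {\<zeta>. \<zeta> ^ k = 1}"
  proof
    assume "U \<subseteq> {\<zeta>. \<zeta> ^ k = 1}"
    then have "card U \<le> k"
      using card_mono card_roots_of_unity_le[OF k(1), where 'k = 'k] by (metis le_trans)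
    then show False using card_roots_of_unity[OF assms] k by (simp add: U_def)
  qed
  then obtain \<eta> :: 'k where \<eta>: "\<eta> ^ n = 1" "\<eta> ^ k \<noteq> 1" by (auto simp: U_def)
  have "\<eta> ^ j = \<eta> ^ (n * (j div n) + k)" by (simp add: k_def)
  also have "\<dots> = \<eta> ^ k" using \<eta>(1) by (simp add: power_add power_mult)
  finally have \<eta>j: "\<eta> ^ j \<noteq> 1" using \<eta>(2) by simp
  have "\<eta> \<noteq> 0" using \<eta>(1) \<open>n > 0\<close> by (auto simp: power_0_left)
  have "(\<Sum>\<zeta>\<in>U. \<zeta> ^ j) = (\<Sum>\<zeta>\<in>U. (\<eta> * \<zeta>) ^ j)"
    by (rule sum.reindex_bij_witness[of _ "\<lambda>\<zeta>. \<eta> * \<zeta>" "\<lambda>\<zeta>. \<zeta> / \<eta>"])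
      (use \<eta>(1) \<open>\<eta> \<noteq> 0\<close> in \<open>auto simp: U_def power_mult_distrib power_divide\<close>)
  also have "\<dots> = \<eta> ^ j * (\<Sum>\<zeta>\<in>U. \<zeta> ^ j)"
    by (simp add: power_mult_distrib sum_distrib_left)
  finally have "(\<Sum>\<zeta>\<in>U. \<zeta> ^ j) = 0" using \<eta>j by (metis mult_cancel_right1)
  then show ?thesis using False by (simp add: U_def)
qed


section \<open>Simple radical extensions of the rational function field\<close>

context field_embedding
begin

lemma dependent_powers:
  assumes "finite T" "card T \<le> N" "\<And>i. h ^ i \<in> module.span (\<lambda>c z. emb c * z) T"
  shows "\<exists>c. (\<exists>i\<le>N. c i \<noteq> 0) \<and> (\<Sum>i\<le>N. emb (c i) * h ^ i) = 0"
proof (cases "inj_on (\<lambda>i. h ^ i) {..N}")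
  case True
  interpret V: vector_space "\<lambda>c z. emb c * z" by (rule vector_space_emb)
  let ?B = "(\<lambda>i. h ^ i) ` {..N}"
  have "card ?B = Suc N" using True by (simp add: card_image)
  moreover have "?B \<subseteq> V.span T" using assms(3) by auto
  ultimately have "V.dependent ?B"
    using V.independent_span_bound[OF assms(1), of ?B] assms(2) by fastforce
  then obtain u v where u: "v \<in> ?B" "u v \<noteq> 0" "(\<Sum>v\<in>?B. emb (u v) * v) = 0"
    using V.dependent_finite[of ?B] by auto
  then obtain i where "i \<le> N" "u (h ^ i) \<noteq> 0" by auto
  moreover have "(\<Sum>i\<le>N. emb (u (h ^ i)) * h ^ i) = 0"
    using u(3) True by (simp add: sum.reindex)
  ultimately show ?thesis by (intro exI[of _ "\<lambda>i. u (h ^ i)"]) blast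
next
  case False
  then obtain i j where ij: "i \<le> N" "j \<le> N" "i \<noteq> j" "h ^ i = h ^ j"
    by (auto simp: inj_on_def)
  define c where "c k = (if k = i then 1 else if k = j then - 1 else (0 :: 'k))" for k
  have "(\<Sum>k\<le>N. emb (c k) * h ^ k) = (\<Sum>k\<in>{i, j}. emb (c k) * h ^ k)"
    using ij by (intro sum.mono_neutral_right) (auto simp: c_def)
  also have "\<dots> = 0" using ij by (simp add: c_def emb_one emb_uminus)
  finally show ?thesis
    using ij by (intro exI[of _ c]) (auto simp: c_def)
qed

text \<open>
  Dividing an algebraic relation by its lowest term gives \<open>1 + h s = 0\<close> with \<open>s\<close> a polynomial
  in \<open>h\<close>.
\<close>

lemma inverse_mem_if_algebraic:
  assumes S: "subring_set S" "range emb \<subseteq> S" "h \<in> S" "h \<noteq> 0"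
    and c: "k \<le> N" "c k \<noteq> 0" "(\<Sum>i\<le>N. emb (c i) * h ^ i) = 0"
  shows "inverse h \<in> S"
proof -
  define j where "j = (LEAST i. c i \<noteq> 0)"
  have cj: "c j \<noteq> 0" unfolding j_def by (rule LeastI) (rule c(2))
  have below: "c i = 0" if "i < j" for i
    using not_less_Least[of i "\<lambda>i. c i \<noteq> 0"] that by (auto simp: j_def)
  have "j \<le> N" using below[of k] c(1,2) by (cases "j \<le> N") auto
  define s where "s = (\<Sum>i\<in>{j<..N}. emb (c i / c j) * h ^ (i - Suc j))"
  have "0 = (\<Sum>i\<in>{j..N}. emb (c i) * h ^ i)"
    unfolding c(3)[symmetric] using below by (intro sum.mono_neutral_right) (auto simp: not_le)
  also have "\<dots> = emb (c j) * h ^ j + (\<Sum>i\<in>{j<..N}. emb (c i) * h ^ i)"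
    using \<open>j \<le> N\<close> by (subst sum.remove[of _ j]) (auto intro!: sum.cong)
  also have "(\<Sum>i\<in>{j<..N}. emb (c i) * h ^ i) = emb (c j) * h ^ Suc j * s"
    unfolding s_def sum_distrib_left
  proof (rule sum.cong)
    fix i
    assume "i \<in> {j<..N}"
    then have "h ^ i = h ^ (Suc j + (i - Suc j))" by simp
    then have "h ^ i = h ^ Suc j * h ^ (i - Suc j)" unfolding power_add .
    then show "emb (c i) * h ^ i = emb (c j) * h ^ Suc j * (emb (c i / c j) * h ^ (i - Suc j))"
      using cj by (simp add: emb_divide)
  qed simp
  also have "emb (c j) * h ^ j + emb (c j) * h ^ Suc j * s = emb (c j) * h ^ j * (1 + h * s)"
    by (simp add: algebra_simps)
  finally have "1 + h * s = 0" using cj S(4) by auto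
  then have "h * (- s) = 1" by (simp add: add_eq_0_iff2)
  then have "inverse h = - s" by (rule inverse_unique)
  also have "\<dots> = 0 - s" by simp
  also have "\<dots> \<in> S"
    unfolding s_def using S(2,3)
    by (intro subring_setD[OF S(1)] subring_set_sum[OF S(1)] subring_set_power[OF S(1)]) auto
  finally show ?thesis .
qed

lemma map_poly_emb_simps:
  "map_poly emb (p + q) = map_poly emb p + map_poly emb q"
  "map_poly emb (p - q) = map_poly emb p - map_poly emb q"
  "map_poly emb (p * q) = map_poly emb p * map_poly emb q"
  by (auto simp: poly_eq_iff coeff_map_poly emb_add emb_diff coeff_mult emb_sum emb_mult)

end

locale radical_extension = rational_function_extension \<phi>
  for \<phi> :: "'k::alg_closed_field poly fract \<Rightarrow> 'f::field" +
  fixes z :: 'f and f :: "'k poly" and m :: nat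
  assumes m_ge_2: "m \<ge> 2"
    and of_nat_m: "of_nat m \<noteq> (0 :: 'k)"
    and squarefree: "rsquarefree f"
    and coprime: "coprime m (Polynomial.degree f)"
    and z_power: "z ^ m = pol f"
    and generated: "adjoin \<phi> {z} = UNIV"
begin

definition eval_at :: "'f \<Rightarrow> 'k poly fract poly \<Rightarrow> 'f" where
  "eval_at v p = poly (map_poly \<phi> p) v"

lemma eval_at_simps:
  "eval_at v (p + q) = eval_at v p + eval_at v q"
  "eval_at v (p - q) = eval_at v p - eval_at v q"
  "eval_at v (p * q) = eval_at v p * eval_at v q"
  "eval_at v [:c:] = \<phi> c"
  by (auto simp: eval_at_def map_poly_emb_simps map_poly_pCons)

lemma eval_at_sum: "eval_at v (sum p I) = (\<Sum>i\<in>I. eval_at v (p i))"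
  by (induction I rule: infinite_finite_induct) (auto simp: eval_at_simps, simp_all add: eval_at_def)

lemma eval_at_monom: "eval_at v (monom c i) = \<phi> c * v ^ i"
  by (simp add: eval_at_def map_poly_monom poly_monom)

text \<open>The minimal polynomial of \<open>z\<close> over \<open>K(x)\<close>, as the independence of the powers of \<open>z\<close> shows.\<close>

definition modulus :: "'k poly fract poly" where
  "modulus = monom 1 m - [:to_fract f:]"

lemma eval_at_modulus: "v ^ m = pol f \<Longrightarrow> eval_at v modulus = 0"
  by (simp add: modulus_def eval_at_simps eval_at_monom emb_one pol_def)

lemma degree_modulus: "Polynomial.degree modulus = m"
  unfolding modulus_def diff_conv_add_uminus using m_ge_2
  by (subst degree_add_eq_left) (auto simp: degree_monom_eq)

lemma eval_at_mod:
  assumes "v ^ m = pol f"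
  shows "eval_at v (p mod modulus) = eval_at v p"
proof -
  have "eval_at v p = eval_at v (p div modulus * modulus + p mod modulus)"
    by (simp only: div_mult_mod_eq)
  also have "\<dots> = eval_at v (p mod modulus)"
    by (simp only: eval_at_simps eval_at_modulus[OF assms]) simp
  finally show ?thesis by simp
qed

lemma eval_at_eq_sum:
  assumes "p = 0 \<or> Polynomial.degree p < m"
  shows "eval_at v p = (\<Sum>t<m. \<phi> (coeff p t) * v ^ t)"
proof -
  have "p = (\<Sum>t<m. monom (coeff p t) t)"
    using assms by (auto simp: poly_eq_iff coeff_sum coeff_eq_0)
  then show ?thesis
    by (metis (no_types, lifting) eval_at_sum eval_at_monom sum.cong)
qed

lemma degree_mod_modulus:
  "p mod modulus = 0 \<or> Polynomial.degree (p mod modulus) < m"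
  using degree_mod_less[of modulus p] degree_modulus m_ge_2 by fastforce

lemma eval_at_sum_form:
  assumes "v ^ m = pol f"
  shows "eval_at v p = (\<Sum>t<m. \<phi> (coeff (p mod modulus) t) * v ^ t)"
  using eval_at_mod[OF assms] eval_at_eq_sum[OF degree_mod_modulus] by metis

lemma subring_set_range_eval_at: "subring_set (range (eval_at z))"
  unfolding subring_set_def
proof (intro conjI ballI)
  show "1 \<in> range (eval_at z)"
    by (rule range_eqI[of _ _ "[:1:]"]) (simp add: eval_at_simps emb_one)
  fix a b
  assume "a \<in> range (eval_at z)" "b \<in> range (eval_at z)"
  then obtain p q where "a = eval_at z p" "b = eval_at z q" by blast
  then show "a - b \<in> range (eval_at z)" "a * b \<in> range (eval_at z)"
    by (auto simp flip: eval_at_simps)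
qed

lemma powers_dependent_if_mem_range:
  assumes "h \<in> range (eval_at z)"
  shows "\<exists>c. (\<exists>i\<le>m. c i \<noteq> 0) \<and> (\<Sum>i\<le>m. \<phi> (c i) * h ^ i) = 0"
proof (rule dependent_powers)
  interpret V: vector_space "\<lambda>c z. \<phi> c * z" by (rule vector_space_emb)
  show "finite ((\<lambda>t. z ^ t) ` {..<m})" by simp
  show "card ((\<lambda>t. z ^ t) ` {..<m}) \<le> m" using card_image_le[of "{..<m}"] by simp
  fix i
  have "h ^ i \<in> range (eval_at z)"
    by (rule subring_set_power[OF subring_set_range_eval_at assms])
  then obtain p where "h ^ i = eval_at z p" by blast
  then have "h ^ i = (\<Sum>t<m. \<phi> (coeff (p mod modulus) t) * z ^ t)"
    by (simp only: eval_at_sum_form[OF z_power])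
  also have "\<dots> \<in> V.span ((\<lambda>t. z ^ t) ` {..<m})"
    by (intro V.span_sum V.span_scale V.span_base imageI)
  finally show "h ^ i \<in> V.span ((\<lambda>t. z ^ t) ` {..<m})" .
qed

lemma range_eval_at: "range (eval_at z) = UNIV"
proof -
  let ?S = "range (eval_at z)"
  have sub: "range \<phi> \<subseteq> ?S"
    by (metis eval_at_simps(4) image_subsetI rangeI)
  have "z \<in> ?S"
    by (rule range_eqI[of _ _ "monom 1 1"]) (simp add: eval_at_monom emb_one)
  moreover have "is_subfield ?S"
    unfolding is_subfield_def
  proof (intro conjI ballI)
    fix h
    assume h: "h \<in> ?S"
    show "inverse h \<in> ?S"
    proof (cases "h = 0")
      case True
      then show ?thesis using h by simp
    next
      case False
      then show ?thesis
        using powers_dependent_if_mem_range[OF h]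
          inverse_mem_if_algebraic[OF subring_set_range_eval_at sub h] by blast
    qed
  qed (use subring_setD[OF subring_set_range_eval_at] in blast)+
  ultimately have "adjoin \<phi> {z} \<subseteq> ?S"
    unfolding adjoin_def using sub by (intro hull_minimal) auto
  then show ?thesis using generated by auto
qed

lemma ex_coordinates: "\<exists>g. h = (\<Sum>t<m. \<phi> (g t) * z ^ t)"
proof -
  obtain p where "h = eval_at z p" using range_eval_at by (metis UNIV_I imageE)
  then show ?thesis using eval_at_sum_form[OF z_power] by blast
qed

sublocale bounded_algebraic_extension \<phi> m
  using powers_dependent_if_mem_range range_eval_at by unfold_locales auto

text \<open>
  Total ramification, in the form that is used: on \<open>K(x)\<close> the valuation is \<open>m\<close> times the
  valuation \<open>ord\<close> below, while the value \<open>s\<close> of \<open>z\<close> is prime to \<open>m\<close>. Then the terms of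
  \<open>\<Sum> g\<^sub>t z\<^sup>t\<close> have values that differ modulo \<open>m\<close>, so they determine the value of the sum.
\<close>

definition ramified_valuation :: "'f set \<Rightarrow> ('k poly fract \<Rightarrow> int) \<Rightarrow> int \<Rightarrow> ('f \<Rightarrow> int) \<Rightarrow> bool" where
  "ramified_valuation R ord s w \<longleftrightarrow> discrete_valuation R w \<and>
     (\<forall>c. c \<noteq> 0 \<longrightarrow> w (\<phi> c) = int m * ord c) \<and> w z = s \<and> coprime s (int m)"

lemma z_nonzero: "z \<noteq> 0"
proof -
  have "f \<noteq> 0" using squarefree by (simp add: rsquarefree_def)
  then show ?thesis using z_power m_ge_2 by (auto simp: power_0_left)
qed

text \<open>
  The equation \<open>z\<^sup>m = f\<close> gives \<open>m w(z) = e ord(f)\<close> with the ramification index \<open>e \<le> m\<close>; as \<open>m\<close>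
  is prime to \<open>ord(f)\<close>, this forces \<open>e = m\<close>.
\<close>

lemma ramified_valuationI:
  assumes w: "discrete_valuation R w" and e: "e \<in> {1..int m}"
    and \<phi>: "\<And>c. c \<noteq> 0 \<Longrightarrow> w (\<phi> c) = e * ord c" and s: "coprime (ord (to_fract f)) (int m)"
  shows "ramified_valuation R ord (ord (to_fract f)) w"
proof -
  interpret discrete_valuation R w by fact
  have "f \<noteq> 0" using squarefree by (simp add: rsquarefree_def)
  have *: "int m * w z = e * ord (to_fract f)"
    using \<phi>[of "to_fract f"] \<open>f \<noteq> 0\<close> w_power[OF z_nonzero, of m] z_power by (simp add: pol_def)
  then have "int m dvd e * ord (to_fract f)" by (metis dvd_triv_left)
  then have "int m dvd e"
    using s by (simp add: coprime_commute coprime_dvd_mult_left_iff)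
  then have "int m \<le> e" using e by (intro zdvd_imp_le) auto
  then have "e = int m" using e by simp
  then show ?thesis
    using * w \<phi> s m_ge_2 by (simp add: ramified_valuation_def)
qed

lemma ramified_valuation_sum:
  assumes w: "ramified_valuation R ord s w" and t0: "t0 < m" "g t0 \<noteq> 0"
  defines "h \<equiv> (\<Sum>t<m. \<phi> (g t) * z ^ t)"
  shows "h \<noteq> 0"
    and "n \<le> w h \<longleftrightarrow> (\<forall>t<m. g t \<noteq> 0 \<longrightarrow> n \<le> int m * ord (g t) + int t * s)"
proof -
  interpret discrete_valuation R w using w by (simp add: ramified_valuation_def)
  define I where "I = {t. t < m \<and> g t \<noteq> 0}"
  have I: "finite I" "I \<noteq> {}" using t0 by (auto simp: I_def)
  have val: "w (\<phi> (g t) * z ^ t) = int m * ord (g t) + int t * s" if "t \<in> I" for t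
    using that w z_nonzero by (simp add: I_def w_mult w_power ramified_valuation_def)
  have "inj_on (\<lambda>t. w (\<phi> (g t) * z ^ t)) I"
  proof (rule inj_onI)
    fix t t'
    assume t: "t \<in> I" "t' \<in> I" "w (\<phi> (g t) * z ^ t) = w (\<phi> (g t') * z ^ t')"
    then have "int m * ord (g t) + int t * s = int m * ord (g t') + int t' * s"
      by (simp only: val)
    then have "(int t - int t') * s = int m * (ord (g t') - ord (g t))"
      by (simp add: algebra_simps)
    then have "int m dvd (int t - int t') * s" by (metis dvd_triv_left)
    then have "int m dvd int t - int t'"
      using w by (simp add: ramified_valuation_def coprime_commute coprime_dvd_mult_left_iff)
    moreover have "\<bar>int t - int t'\<bar> < int m" using t(1,2) by (auto simp: I_def)
    ultimately show "t = t'" using dvd_imp_le_int[of "int t - int t'" "int m"] by (cases "t = t'") auto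
  qed
  moreover have "h = (\<Sum>t\<in>I. \<phi> (g t) * z ^ t)"
    unfolding h_def by (intro sum.mono_neutral_right) (auto simp: I_def)
  moreover have "\<phi> (g t) * z ^ t \<noteq> 0" if "t \<in> I" for t
    using that z_nonzero by (auto simp: I_def)
  ultimately have *: "h \<noteq> 0" "w h = Min ((\<lambda>t. w (\<phi> (g t) * z ^ t)) ` I)"
    using w_sum_distinct[OF I, of "\<lambda>t. \<phi> (g t) * z ^ t"] by auto
  show "h \<noteq> 0" by fact
  have "n \<le> w h \<longleftrightarrow> (\<forall>t\<in>I. n \<le> w (\<phi> (g t) * z ^ t))"
    unfolding *(2) using I by (subst Min_ge_iff) auto
  then show "n \<le> w h \<longleftrightarrow> (\<forall>t<m. g t \<noteq> 0 \<longrightarrow> n \<le> int m * ord (g t) + int t * s)"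
    using val by (auto simp: I_def)
qed

text \<open>
  Such a valuation is determined by its values on \<open>K(x)\<close> and at \<open>z\<close>, so there is only one place
  over infinity and one over each root of \<open>f\<close>.
\<close>

lemma ramified_valuation_unique:
  assumes "ramified_valuation R ord s w" "ramified_valuation R' ord s w'"
  shows "R = R'"
proof -
  interpret R: discrete_valuation R w using assms(1) by (simp add: ramified_valuation_def)
  interpret R': discrete_valuation R' w' using assms(2) by (simp add: ramified_valuation_def)
  have "h \<in> R \<longleftrightarrow> h \<in> R'" for h
  proof -
    obtain g where g: "h = (\<Sum>t<m. \<phi> (g t) * z ^ t)" using ex_coordinates by blast
    show ?thesis
    proof (cases "\<exists>t<m. g t \<noteq> 0")
      case True
      then obtain t where t: "t < m" "g t \<noteq> 0" by blast
      show ?thesis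
        using ramified_valuation_sum[where g = g, OF assms(1) t] ramified_valuation_sum[where g = g, OF assms(2) t]
        by (simp add: R.mem_iff R'.mem_iff g)
    next
      case False
      then have "h = 0" using g by simp
      then show ?thesis by (simp add: R.zero_mem R'.zero_mem)
    qed
  qed
  then show ?thesis by blast
qed

lemma ex_ramified_valuation_at_root:
  assumes "valuation_ring (const_emb \<phi>) R" "over_point \<alpha> R" "poly f \<alpha> = 0"
  shows "\<exists>w. ramified_valuation R (ord_at \<alpha>) 1 w"
proof -
  have "f \<noteq> 0" using squarefree by (simp add: rsquarefree_def)
  moreover have "order \<alpha> f = 0 \<or> order \<alpha> f = 1"
    using squarefree by (simp add: rsquarefree_def)
  ultimately have "order \<alpha> f = 1"
    using assms(3) order_root[of f \<alpha>] by auto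
  then have "ord_at \<alpha> (to_fract f) = 1"
    using ord_at_divide[of f 1 \<alpha>] \<open>f \<noteq> 0\<close> by (simp add: order_0I)
  then show ?thesis
    using ex_valuation_at_point[OF assms(1,2)] ramified_valuationI[of R _ _ "ord_at \<alpha>"]
    by (metis coprime_1_left)
qed

lemma ex_ramified_valuation_at_infinity:
  assumes "valuation_ring (const_emb \<phi>) R" "over_infinity R"
  shows "\<exists>w. ramified_valuation R ord_inf (- int (Polynomial.degree f)) w"
proof -
  have "f \<noteq> 0" using squarefree by (simp add: rsquarefree_def)
  then have *: "ord_inf (to_fract f) = - int (Polynomial.degree f)"
    using ord_inf_divide[of f 1] by simp
  moreover have "coprime (- int (Polynomial.degree f)) (int m)"
    using coprime by (simp add: coprime_commute)
  ultimately show ?thesis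
    using ex_valuation_at_infinity[OF assms] ramified_valuationI[of R _ _ ord_inf] by metis
qed

lemma valuation_ring_at_root_unique:
  assumes "valuation_ring (const_emb \<phi>) R" "over_point \<alpha> R"
    "valuation_ring (const_emb \<phi>) S" "over_point \<alpha> S" "poly f \<alpha> = 0"
  shows "R = S"
  using ex_ramified_valuation_at_root[OF assms(1,2,5)] ex_ramified_valuation_at_root[OF assms(3,4,5)]
    ramified_valuation_unique by blast

lemma valuation_ring_at_infinity_unique:
  assumes "valuation_ring (const_emb \<phi>) R" "over_infinity R"
    "valuation_ring (const_emb \<phi>) S" "over_infinity S"
  shows "R = S"
  using ex_ramified_valuation_at_infinity[OF assms(1,2)] ex_ramified_valuation_at_infinity[OF assms(3,4)]
    ramified_valuation_unique by blast

text \<open>Over a root of \<open>f\<close> the terms of the sum have distinct values.\<close>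

lemma coordinates_zero:
  assumes "(\<Sum>t<m. \<phi> (g t) * z ^ t) = 0" "t < m"
  shows "g t = 0"
proof (rule ccontr)
  assume "g t \<noteq> 0"
  have "Polynomial.degree f > 0"
    using coprime m_ge_2 by (cases "Polynomial.degree f = 0") auto
  then obtain \<alpha> where "poly f \<alpha> = 0" using alg_closed_imp_poly_has_root by blast
  then obtain R w where "ramified_valuation R (ord_at \<alpha>) 1 w"
    using ex_valuation_ring_over_point[of \<alpha>] ex_ramified_valuation_at_root by blast
  from ramified_valuation_sum(1)[where g = g, OF this assms(2) \<open>g t \<noteq> 0\<close>] assms(1) show False by simp
qed


section \<open>Conjugation by roots of unity\<close>

text \<open>
  The automorphism over \<open>K(x)\<close> that sends \<open>z\<close> to \<open>\<zeta> z\<close>. The polynomial that represents \<open>h\<close> does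
  not matter, because \<open>\<zeta> z\<close> is a root of the minimal polynomial of \<open>z\<close>.
\<close>

definition conjugate :: "'k \<Rightarrow> 'f \<Rightarrow> 'f" where
  "conjugate \<zeta> h = eval_at (pol [:\<zeta>:] * z) (SOME p. eval_at z p = h)"

lemma const_power: "pol [:c ^ n:] = pol [:c:] ^ n"
  by (simp add: poly_const_pow flip: pol_power)

lemma const_sum: "pol [:sum c I:] = (\<Sum>i\<in>I. pol [:c i:])"
proof (induction I rule: infinite_finite_induct)
  case (insert i I)
  have "pol [:c i + sum c I:] = pol [:c i:] + pol [:sum c I:]"
    by (simp flip: pol_simps)
  then show ?case using insert by simp
qed (auto simp: pol_simps)

context
  fixes \<zeta> :: 'k
  assumes root_of_unity: "\<zeta> ^ m = 1"
begin

lemma conjugate_power: "(pol [:\<zeta>:] * z) ^ m = pol f"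
  using const_power[of \<zeta> m] root_of_unity
  by (simp add: power_mult_distrib z_power pol_simps flip: one_pCons)

lemma conjugate_eval_at: "conjugate \<zeta> (eval_at z p) = eval_at (pol [:\<zeta>:] * z) p"
proof -
  define q where "q = (SOME q. eval_at z q = eval_at z p)"
  have "eval_at z q = eval_at z p" unfolding q_def by (rule someI) (rule refl)
  then have "eval_at z ((q - p) mod modulus) = 0"
    by (simp add: eval_at_mod[OF z_power] eval_at_simps)
  then have "(\<Sum>t<m. \<phi> (coeff ((q - p) mod modulus) t) * z ^ t) = 0"
    using eval_at_eq_sum[OF degree_mod_modulus] by simp
  then have "coeff ((q - p) mod modulus) t = 0" if "t < m" for t
    using coordinates_zero[of "coeff ((q - p) mod modulus)"] that by blast
  then have "eval_at (pol [:\<zeta>:] * z) ((q - p) mod modulus) = 0"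
    by (subst eval_at_eq_sum[OF degree_mod_modulus]) simp
  then have "eval_at (pol [:\<zeta>:] * z) q = eval_at (pol [:\<zeta>:] * z) p"
    by (simp add: eval_at_mod[OF conjugate_power] eval_at_simps)
  then show ?thesis by (simp add: conjugate_def q_def)
qed

lemma conjugate_hom:
  "conjugate \<zeta> 1 = 1" "conjugate \<zeta> (a - b) = conjugate \<zeta> a - conjugate \<zeta> b" "conjugate \<zeta> (a * b) = conjugate \<zeta> a * conjugate \<zeta> b"
proof -
  obtain p q where pq: "a = eval_at z p" "b = eval_at z q"
    using range_eval_at by (metis UNIV_I imageE)
  show "conjugate \<zeta> (a - b) = conjugate \<zeta> a - conjugate \<zeta> b" "conjugate \<zeta> (a * b) = conjugate \<zeta> a * conjugate \<zeta> b"
    unfolding pq eval_at_simps(2,3)[symmetric] conjugate_eval_at by (simp_all add: eval_at_simps)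
  show "conjugate \<zeta> 1 = 1"
    using conjugate_eval_at[of "[:1:]"] by (simp add: eval_at_simps emb_one)
qed

lemma conjugate_phi: "conjugate \<zeta> (\<phi> c) = \<phi> c"
  using conjugate_eval_at[of "[:c:]"] by (simp add: eval_at_simps)

lemma conjugate_pol: "conjugate \<zeta> (pol p) = pol p"
  by (simp add: pol_def conjugate_phi)

lemma conjugate_coordinates:
  "conjugate \<zeta> (\<Sum>t<m. \<phi> (g t) * z ^ t) = (\<Sum>t<m. \<phi> (g t) * (pol [:\<zeta>:] * z) ^ t)"
  using conjugate_eval_at[of "\<Sum>t<m. monom (g t) t"] by (simp add: eval_at_sum eval_at_monom)

lemma conjugate_inverse: "conjugate \<zeta> (inverse a) = inverse (conjugate \<zeta> a)"
proof (cases "a = 0")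
  case True
  then show ?thesis using conjugate_hom(2)[of 0 0] by simp
next
  case False
  then have "conjugate \<zeta> a * conjugate \<zeta> (inverse a) = 1"
    using conjugate_hom(3)[of a "inverse a"] conjugate_hom(1) by simp
  then show ?thesis by (metis inverse_unique)
qed

lemma conjugate_surj: "\<exists>a. conjugate \<zeta> a = h"
proof -
  have "\<zeta> \<noteq> 0" using root_of_unity m_ge_2 by (auto simp: power_0_left)
  obtain g where g: "h = (\<Sum>t<m. \<phi> (g t) * z ^ t)" using ex_coordinates by blast
  have "\<phi> (g t * to_fract [:inverse \<zeta> ^ t:]) * (pol [:\<zeta>:] * z) ^ t = \<phi> (g t) * z ^ t" for t
  proof -
    have "pol [:inverse \<zeta> ^ t:] * pol [:\<zeta> ^ t:] = 1"
      using \<open>\<zeta> \<noteq> 0\<close> by (simp add: power_inverse flip: pol_simps one_pCons)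
    then show ?thesis
      by (simp add: emb_mult power_mult_distrib mult.assoc flip: const_power pol_def)
  qed
  then have "conjugate \<zeta> (\<Sum>t<m. \<phi> (g t * to_fract [:inverse \<zeta> ^ t:]) * z ^ t) = h"
    unfolding conjugate_coordinates g by simp
  then show ?thesis by blast
qed

lemma valuation_ring_conjugate:
  assumes "valuation_ring (const_emb \<phi>) R"
  shows "valuation_ring (const_emb \<phi>) {h. conjugate \<zeta> h \<in> R}"
proof -
  interpret valuation_subring R
    using assms(1) by (rule valuation_ring_imp_valuation_subring)
  obtain h where "h \<notin> R" using assms by (auto simp: valuation_ring_def)
  obtain a where a: "conjugate \<zeta> a = h" using conjugate_surj by blast
  obtain c where c: "c \<in> R" "c \<notin> range (const_emb \<phi>)"
    using assms by (auto simp: valuation_ring_def)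
  obtain b where b: "conjugate \<zeta> b = c" using conjugate_surj by blast
  have const: "conjugate \<zeta> (const_emb \<phi> d) = const_emb \<phi> d" for d
    by (simp add: conjugate_phi)
  have "range (const_emb \<phi>) \<subseteq> {h. conjugate \<zeta> h \<in> R}"
    using const const_mem[OF assms] const_emb_eq_pol by auto
  moreover have "b \<in> {h. conjugate \<zeta> h \<in> R}" using b c by simp
  moreover have "b \<notin> range (const_emb \<phi>)" using b c const by blast
  moreover have "a \<notin> {h. conjugate \<zeta> h \<in> R}" using a \<open>h \<notin> R\<close> by simp
  ultimately show ?thesis
    unfolding valuation_ring_def
    using one_mem diff_mem mult_mem mem_or_inverse_mem
    by (auto simp: conjugate_hom conjugate_inverse)
qed

lemma over_point_conjugate:
  assumes "over_point \<beta> R"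
  shows "over_point \<beta> {h. conjugate \<zeta> h \<in> R}"
  using assms by (auto simp: over_point_def nonunits_def conjugate_inverse conjugate_pol)

end

text \<open>Orthogonality of the powers of the roots of unity isolates a single coordinate.\<close>

lemma average_conjugate:
  assumes h: "h = (\<Sum>t<m. \<phi> (g t) * z ^ t)" and k: "k < m"
  shows "(\<Sum>\<zeta> | \<zeta> ^ m = 1. pol [:\<zeta> ^ (m - k):] * conjugate \<zeta> h) = pol [:of_nat m:] * (\<phi> (g k) * z ^ k)"
proof -
  have "(\<Sum>\<zeta> | \<zeta> ^ m = 1. pol [:\<zeta> ^ (m - k):] * conjugate \<zeta> h) =
      (\<Sum>\<zeta> | \<zeta> ^ m = 1. \<Sum>t<m. \<phi> (g t) * z ^ t * pol [:\<zeta> ^ (t + (m - k)):])"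
  proof (intro sum.cong refl)
    fix \<zeta> :: 'k
    assume "\<zeta> \<in> {\<zeta>. \<zeta> ^ m = 1}"
    then have "conjugate \<zeta> h = (\<Sum>t<m. \<phi> (g t) * (pol [:\<zeta>:] * z) ^ t)"
      unfolding h by (simp add: conjugate_coordinates)
    then show "pol [:\<zeta> ^ (m - k):] * conjugate \<zeta> h =
        (\<Sum>t<m. \<phi> (g t) * z ^ t * pol [:\<zeta> ^ (t + (m - k)):])"
      unfolding const_power
      by (simp only: sum_distrib_left power_mult_distrib power_add mult_ac)
  qed
  also have "\<dots> = (\<Sum>t<m. \<phi> (g t) * z ^ t * pol [:\<Sum>\<zeta> | \<zeta> ^ m = 1. \<zeta> ^ (t + (m - k)):])"
    by (subst sum.swap) (simp only: sum_distrib_left const_sum)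
  also have "\<dots> = (\<Sum>t<m. if t = k then pol [:of_nat m:] * (\<phi> (g k) * z ^ k) else 0)"
  proof (intro sum.cong refl)
    fix t
    assume t: "t \<in> {..<m}"
    have "m dvd t + (m - k) \<longleftrightarrow> t = k"
    proof
      assume "m dvd t + (m - k)"
      then obtain i where i: "t + (m - k) = m * i" by blast
      have "0 < t + (m - k)" "t + (m - k) < m * 2" using t k by auto
      then have "0 < i" "i < 2" unfolding i by simp_all
      then have "i = 1" by simp
      then show "t = k" using i k by simp
    qed (use k in simp)
    then show "\<phi> (g t) * z ^ t * pol [:\<Sum>\<zeta> | \<zeta> ^ m = 1. \<zeta> ^ (t + (m - k)):] =
        (if t = k then pol [:of_nat m:] * (\<phi> (g k) * z ^ k) else 0)"
      by (simp add: sum_powers_roots_of_unity[OF of_nat_m] pol_simps)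
  qed
  also have "\<dots> = pol [:of_nat m:] * (\<phi> (g k) * z ^ k)" using k by simp
  finally show ?thesis .
qed

end


section \<open>Rational functions with poles only at one point and at infinity\<close>

lemma ex_clear_denominator_at_point:
  fixes p q :: "'k::alg_closed_field poly"
  assumes "p \<noteq> 0" "q \<noteq> 0" "\<And>\<beta>. \<beta> \<noteq> \<alpha> \<Longrightarrow> order \<beta> q \<le> order \<beta> p"
  shows "\<exists>k s. p * [:- \<alpha>, 1:] ^ k = s * q"
  using assms
proof (induction "Polynomial.degree q" arbitrary: p q)
  case 0
  then obtain c where c: "q = [:c:]" "c \<noteq> 0" by (metis degree_eq_zeroE pCons_0_0)
  then have "p * [:- \<alpha>, 1:] ^ 0 = smult (inverse c) p * q" by simp
  then show ?case by blast
next
  case (Suc n)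
  then obtain \<beta> where "poly q \<beta> = 0"
    using alg_closed_imp_poly_has_root[of q] by auto
  define l where "l = [:- \<beta>, 1:]"
  obtain q' where q: "q = l * q'"
    using \<open>poly q \<beta> = 0\<close> by (auto simp: poly_eq_0_iff_dvd l_def)
  have nz: "q' \<noteq> 0" "l \<noteq> 0" using q Suc.prems(2) by auto
  moreover have "Polynomial.degree l = 1" by (simp add: l_def)
  ultimately have deg: "n = Polynomial.degree q'"
    using Suc(2) unfolding q by (simp add: degree_mult_eq)
  have ord_q: "order \<gamma> q = order \<gamma> l + order \<gamma> q'" for \<gamma>
    using nz unfolding q by (intro order_mult) simp
  show ?case
  proof (cases "\<beta> = \<alpha>")
    case True
    have "\<exists>k s. p * [:- \<alpha>, 1:] ^ k = s * q'"
      using Suc.prems ord_q nz by (intro Suc(1)[OF deg]) (auto intro: add_leD2)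
    then obtain k s where ks: "p * [:- \<alpha>, 1:] ^ k = s * q'" by blast
    from arg_cong[OF ks, of "\<lambda>t. t * l"]
    have "p * [:- \<alpha>, 1:] ^ Suc k = s * q"
      unfolding q l_def True by (simp only: power_Suc mult_ac)
    then show ?thesis by blast
  next
    case False
    have "order \<beta> l = 1" using order_power_n_n[of \<beta> 1] by (simp add: l_def)
    then have "order \<beta> p \<noteq> 0" using Suc.prems(3)[OF False] ord_q[of \<beta>] by simp
    then have "poly p \<beta> = 0" using order_root by blast
    then obtain p' where p: "p = l * p'"
      by (auto simp: poly_eq_0_iff_dvd l_def)
    have "p' \<noteq> 0" using p Suc.prems(1) by auto
    then have ord_p: "order \<gamma> p = order \<gamma> l + order \<gamma> p'" for \<gamma>
      using nz unfolding p by (intro order_mult) simp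
    have "order \<gamma> q' \<le> order \<gamma> p'" if "\<gamma> \<noteq> \<alpha>" for \<gamma>
      using Suc.prems(3)[OF that] ord_p[of \<gamma>] ord_q[of \<gamma>] by simp
    then have "\<exists>k s. p' * [:- \<alpha>, 1:] ^ k = s * q'"
      using \<open>p' \<noteq> 0\<close> nz by (intro Suc(1)[OF deg])
    then obtain k s where ks: "p' * [:- \<alpha>, 1:] ^ k = s * q'" by blast
    from arg_cong[OF ks, of "\<lambda>t. t * l"]
    have "p * [:- \<alpha>, 1:] ^ k = s * q"
      unfolding p q by (simp only: mult_ac)
    then show ?thesis by blast
  qed
qed

lemma ex_expansion_at_point:
  fixes p :: "'k::field poly"
  assumes "Polynomial.degree p \<le> n"
  shows "\<exists>b. p = (\<Sum>i\<le>n. [:b i:] * [:- \<alpha>, 1:] ^ i)"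
  using assms
proof (induction n arbitrary: p)
  case 0
  then obtain c where "p = [:c:]" by (metis degree_eq_zeroE le_zero_eq)
  then show ?case by (intro exI[of _ "\<lambda>_. c"]) simp
next
  case (Suc n)
  define l where "l = [:- \<alpha>, 1:]"
  have "l dvd p - [:poly p \<alpha>:]"
    unfolding l_def by (simp add: poly_eq_0_iff_dvd[symmetric])
  then obtain q where q: "p - [:poly p \<alpha>:] = l * q" by blast
  have "Polynomial.degree q \<le> n"
  proof (cases "q = 0")
    case False
    have "Polynomial.degree (l * q) \<le> Suc n"
      unfolding q[symmetric] using Suc.prems by (intro degree_diff_le) auto
    moreover have "Polynomial.degree l = 1" "l \<noteq> 0" by (simp_all add: l_def)
    ultimately show ?thesis using False by (simp add: degree_mult_eq)
  qed simp
  from Suc.IH[OF this] obtain b where b: "q = (\<Sum>i\<le>n. [:b i:] * l ^ i)"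
    unfolding l_def by blast
  define b' where "b' i = (case i of 0 \<Rightarrow> poly p \<alpha> | Suc i \<Rightarrow> b i)" for i
  have "p = [:poly p \<alpha>:] + l * q" using q by (simp add: algebra_simps)
  also have "l * q = (\<Sum>i\<le>n. [:b i:] * l ^ Suc i)"
    unfolding b sum_distrib_left by (simp only: power_Suc mult.left_commute)
  also have "[:poly p \<alpha>:] + \<dots> = (\<Sum>i\<le>Suc n. [:b' i:] * l ^ i)"
    by (simp add: sum.atMost_Suc_shift b'_def del: sum.atMost_Suc)
  finally show ?case unfolding l_def by blast
qed

lemma to_fract_power: "to_fract (p ^ n) = to_fract p ^ n"
  by (induction n) auto

lemma ex_laurent_expansion:
  fixes c :: "'k::alg_closed_field poly fract"
  assumes "c \<noteq> 0" "\<And>\<beta>. \<beta> \<noteq> \<alpha> \<Longrightarrow> 0 \<le> ord_at \<beta> c"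
  shows "\<exists>a. c = (\<Sum>j\<in>{ord_at \<alpha> c..- ord_inf c}. to_fract [:a j:] * to_fract [:- \<alpha>, 1:] powi j)"
proof -
  define l where "l = [:- \<alpha>, 1:]"
  have l: "l \<noteq> 0" "Polynomial.degree l = 1" by (auto simp: l_def)
  obtain p q where pq: "p \<noteq> 0" "q \<noteq> 0" "c = to_fract p / to_fract q"
    using assms(1) by (rule fract_nonzero_cases)
  have "\<exists>k s. p * [:- \<alpha>, 1:] ^ k = s * q"
    by (rule ex_clear_denominator_at_point) (use assms(2) pq in \<open>auto simp: ord_at_divide\<close>)
  then obtain k s where ks: "p * l ^ k = s * q" unfolding l_def by blast
  have "p * l ^ k \<noteq> 0" using pq l by simp
  then have s: "s \<noteq> 0" unfolding ks by auto
  have "to_fract p * to_fract (l ^ k) = to_fract s * to_fract q"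
    using ks by (simp flip: to_fract_mult)
  then have c: "c = to_fract s / to_fract (l ^ k)"
    using pq l by (simp add: frac_eq_eq mult.commute)
  define d where "d = order \<alpha> s"
  obtain s' where s': "s = l ^ d * s'"
    using order_1[of \<alpha> s] unfolding l_def d_def by (elim dvdE)
  then have "s' \<noteq> 0" using s by auto
  define n where "n = Polynomial.degree s'"
  have deg_s: "Polynomial.degree s = d + n"
    unfolding s' n_def using \<open>s' \<noteq> 0\<close> l by (simp add: degree_mult_eq degree_power_eq)
  have ords: "ord_at \<alpha> c = int d - int k" "- ord_inf c = int d + int n - int k"
    using s l order_power_n_n[of \<alpha> k] deg_s unfolding c
    by (simp_all add: ord_at_divide ord_inf_divide d_def degree_power_eq l_def[symmetric])
  obtain b where b: "s' = (\<Sum>i\<le>n. [:b i:] * l ^ i)"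
    using ex_expansion_at_point[of s' n \<alpha>] unfolding n_def l_def by blast
  have "c = to_fract l powi (int d - int k) * to_fract s'"
    unfolding c s' using l by (simp add: to_fract_power power_int_diff field_simps)
  also have "\<dots> = (\<Sum>i\<le>n. to_fract [:b i:] * to_fract l powi (int d - int k + int i))"
  proof -
    have "to_fract l powi (int d - int k + int i) = to_fract l powi (int d - int k) * to_fract l ^ i" for i
      using l by (simp add: power_int_add)
    then show ?thesis
      unfolding b to_fract_sum sum_distrib_left to_fract_mult to_fract_power by (simp only: mult_ac)
  qed
  also have "\<dots> = (\<Sum>j\<in>{int d - int k..int d + int n - int k}.
      to_fract [:b (nat (j - (int d - int k))):] * to_fract l powi j)"
    by (rule sum.reindex_bij_witness[of _ "\<lambda>j. nat (j - (int d - int k))" "\<lambda>i. int d - int k + int i"]) auto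
  finally show ?thesis
    unfolding ords l_def by (rule exI[of _ "\<lambda>j. b (nat (j - (int d - int k)))"])
qed


section \<open>Places over points that are not roots\<close>

context radical_extension
begin

lemma unit_in_z:
  assumes "valuation_ring (const_emb \<phi>) R" "over_point \<beta> R" "poly f \<beta> \<noteq> 0"
  shows "unit_in R z"
proof -
  interpret valuation_subring R
    using assms(1) by (rule valuation_ring_imp_valuation_subring)
  have "unit_in R (z ^ m)"
    unfolding z_power by (rule unit_in_pol_if_over_point[OF assms])
  then show ?thesis
    using z_nonzero m_ge_2 power_mem_iff[of m z] power_mem_iff[of m "inverse z"]
    by (simp add: unit_in_def power_inverse)
qed

text \<open>
  The residue field is \<open>K\<close>: a polynomial over \<open>K\<close> that vanishes at the residue of \<open>v\<close> splits into
  linear factors, and one of them vanishes there too.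
\<close>

lemma ex_residue:
  assumes R: "valuation_ring (const_emb \<phi>) R" and v: "v \<in> R"
  shows "q \<noteq> 0 \<Longrightarrow> poly (map_poly (\<lambda>c. pol [:c:]) q) v \<in> nonunits R \<Longrightarrow>
    \<exists>b. v - pol [:b:] \<in> nonunits R"
proof (induction "Polynomial.degree q" arbitrary: q)
  case 0
  then obtain c where "q = [:c:]" "c \<noteq> 0" by (metis degree_eq_zeroE pCons_0_0)
  then show ?case
    using unit_in_const[OF R, of c] 0(3) by (auto simp: map_poly_pCons unit_in_def nonunits_def)
next
  case (Suc n)
  interpret valuation_subring R
    using R by (rule valuation_ring_imp_valuation_subring)
  interpret C: field_embedding "\<lambda>c. pol [:c:]" by (rule field_embedding_pol_const)
  obtain b where "poly q b = 0"
    using Suc(2) alg_closed_imp_poly_has_root[of q] by auto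
  then obtain q' where q: "q = [:- b, 1:] * q'" by (auto simp: poly_eq_0_iff_dvd)
  have "q' \<noteq> 0" using q Suc.prems by auto
  then have deg: "n = Polynomial.degree q'"
    using Suc(2) unfolding q by (simp add: degree_mult_eq del: mult_pCons_left)
  have mem: "poly (map_poly (\<lambda>c. pol [:c:]) q') v \<in> R"
    unfolding poly_altdef using v
    by (intro sum_mem mult_mem power_mem) (auto simp: coeff_map_poly intro: const_mem[OF R])
  have "poly (map_poly (\<lambda>c. pol [:c:]) [:- b, 1:]) v = v - pol [:b:]"
    by (simp add: map_poly_pCons C.emb_one C.emb_uminus)
  then have "(v - pol [:b:]) * poly (map_poly (\<lambda>c. pol [:c:]) q') v \<in> nonunits R"
    using Suc.prems(2) unfolding q C.map_poly_emb_simps by simp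
  from nonunits_prime[OF this diff_mem[OF v const_mem[OF R]] mem]
  show ?case using Suc(1)[OF deg \<open>q' \<noteq> 0\<close>] by blast
qed

lemma nonunits_conjugate:
  assumes "\<zeta> ^ m = 1"
  shows "a \<in> nonunits {h. conjugate \<zeta> h \<in> R} \<longleftrightarrow> conjugate \<zeta> a \<in> nonunits R"
proof -
  have "conjugate \<zeta> a = 0 \<longleftrightarrow> a = 0"
    using conjugate_hom(1)[OF assms] conjugate_hom(2)[OF assms, of 0 0] conjugate_hom(3)[OF assms, of a "inverse a"]
    by (cases "a = 0") auto
  then show ?thesis by (simp add: nonunits_def conjugate_inverse[OF assms])
qed

text \<open>
  Over \<open>\<beta>\<close> with \<open>f(\<beta>) \<noteq> 0\<close> there is more than one place: a place sends \<open>z\<close> to some constant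
  \<open>b \<noteq> 0\<close>, and its conjugate by \<open>\<zeta>\<close> sends \<open>z\<close> to a different multiple of \<open>b\<close>.
\<close>

lemma totally_ramified_imp_over_root:
  assumes R: "valuation_ring (const_emb \<phi>) R" and tot: "totally_ramified \<phi> (nonunits R)"
    and \<beta>: "over_point \<beta> R"
  shows "poly f \<beta> = 0"
proof (rule ccontr)
  assume nz: "poly f \<beta> \<noteq> 0"
  interpret valuation_subring R
    using R by (rule valuation_ring_imp_valuation_subring)
  obtain Q where over: "lies_over \<phi> (nonunits R) Q"
    and unique: "\<And>P'. lies_over \<phi> P' Q \<Longrightarrow> P' = nonunits R"
    using tot unfolding totally_ramified_def by blast
  have Q: "place ratfun_const Q" "\<phi> ` Q \<subseteq> nonunits R"
    using over by (simp_all add: lies_over_def)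
  have "\<not> {\<zeta>::'k. \<zeta> ^ m = 1} \<subseteq> {1}"
    using card_mono[of "{1}" "{\<zeta>::'k. \<zeta> ^ m = 1}"] card_roots_of_unity[OF of_nat_m] m_ge_2 by auto
  then obtain \<zeta> :: 'k where \<zeta>: "\<zeta> ^ m = 1" "\<zeta> \<noteq> 1" by blast
  let ?R' = "{h. conjugate \<zeta> h \<in> R}"
  have "lies_over \<phi> (nonunits ?R') Q"
    unfolding lies_over_def place_iff[of "const_emb \<phi>"]
    using valuation_ring_conjugate[OF \<zeta>(1) R] Q(1,2)
    by (auto simp: nonunits_conjugate[OF \<zeta>(1)] conjugate_phi[OF \<zeta>(1)])
  then have stable: "nonunits ?R' = nonunits R" by (rule unique)
  have z: "unit_in R z" by (rule unit_in_z[OF R \<beta> nz])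
  have "[:- \<beta>, 1:] dvd f - [:poly f \<beta>:]"
    by (simp add: poly_eq_0_iff_dvd[symmetric])
  then obtain g where "f - [:poly f \<beta>:] = g * [:- \<beta>, 1:]" by (metis dvdE mult.commute)
  then have "z ^ m - pol [:poly f \<beta>:] = pol g * pol [:- \<beta>, 1:]"
    unfolding z_power by (simp only: flip: pol_simps)
  moreover have "pol [:0, 1:] \<in> R"
    using over_infinity_iff[OF R] not_over_point_and_infinity[OF R \<beta>] by simp
  ultimately have "z ^ m - pol [:poly f \<beta>:] \<in> nonunits R"
    using mult_nonunits[of "pol [:- \<beta>, 1:]" "pol g"] pol_mem[OF R] \<beta> by (simp add: over_point_def)
  moreover define q where "q = monom 1 m - [:poly f \<beta>:]"
  have "poly (map_poly (\<lambda>c. pol [:c:]) q) z = z ^ m - pol [:poly f \<beta>:]"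
  proof -
    interpret C: field_embedding "\<lambda>c. pol [:c:]" by (rule field_embedding_pol_const)
    show ?thesis
      by (simp add: q_def C.map_poly_emb_simps map_poly_monom poly_monom C.emb_one map_poly_pCons)
  qed
  moreover have "q \<noteq> 0"
  proof -
    have "coeff q m = 1" using m_ge_2 by (simp add: q_def coeff_pCons split: nat.splits)
    then show ?thesis by auto
  qed
  ultimately obtain b where b: "z - pol [:b:] \<in> nonunits R"
    using ex_residue[OF R, of z q] z by (auto simp: unit_in_def)
  \<comment> \<open>The residue \<open>b\<close> of \<open>z\<close> is now also that of \<open>\<zeta> z\<close>.\<close>
  then have "conjugate \<zeta> (z - pol [:b:]) \<in> nonunits R"
    unfolding nonunits_conjugate[OF \<zeta>(1), symmetric] stable .
  moreover have "conjugate \<zeta> z = pol [:\<zeta>:] * z"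
    using conjugate_eval_at[OF \<zeta>(1), of "monom 1 1"] by (simp add: eval_at_monom emb_one)
  ultimately have "pol [:\<zeta>:] * z - pol [:b:] \<in> nonunits R"
    by (simp add: conjugate_hom(2)[OF \<zeta>(1)] conjugate_pol[OF \<zeta>(1)])
  from diff_nonunits[OF this b] have "pol [:\<zeta>:] * z - z \<in> nonunits R" by simp
  also have "pol [:\<zeta>:] * z - z = pol [:\<zeta> - 1:] * z"
  proof -
    have "pol [:\<zeta> - 1:] = pol [:\<zeta>:] - 1"
      using pol_simps(4)[of "[:\<zeta>:]" "[:1:]"] pol_simps(2) by (simp add: one_pCons)
    then show ?thesis by (simp only: left_diff_distrib mult_1_left)
  qed
  finally have "pol [:\<zeta> - 1:] * z \<in> nonunits R" .
  moreover have "unit_in R (pol [:\<zeta> - 1:] * z)"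
    using \<zeta>(2) z by (intro unit_in_mult unit_in_const[OF R]) auto
  ultimately show False by (simp add: nonunits_def unit_in_def)
qed


section \<open>Riemann--Roch spaces and pure gaps\<close>

text \<open>
  The exponents \<open>(t, j)\<close> of the functions \<open>(x - \<alpha>)\<^sup>j z\<^sup>t\<close> with \<open>t < m\<close> whose poles are bounded by
  \<open>k1\<close> at infinity and by \<open>k2\<close> over \<open>\<alpha>\<close>. For fixed \<open>t\<close> they form an interval.
\<close>

definition lattice_points :: "int \<Rightarrow> int \<Rightarrow> (nat \<times> int) set" where
  "lattice_points k1 k2 = (SIGMA t:{..<m}.
     {- ((k2 + int t) div int m)..(k1 - int (Polynomial.degree f) * int t) div int m})"

definition monomial :: "'k \<Rightarrow> nat \<times> int \<Rightarrow> 'f" where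
  "monomial \<alpha> = (\<lambda>(t, j). pol [:- \<alpha>, 1:] powi j * z ^ t)"

lemma finite_lattice_points: "finite (lattice_points k1 k2)"
  by (simp add: lattice_points_def)

lemma mem_lattice_points_iff:
  "(t, j) \<in> lattice_points k1 k2 \<longleftrightarrow> t < m \<and> - k2 \<le> int m * j + int t \<and>
     int m * j + int (Polynomial.degree f) * int t \<le> k1"
proof -
  have m: "int m > 0" using m_ge_2 by simp
  have *: "n \<le> a div int m \<longleftrightarrow> int m * n \<le> a" for n a
  proof
    assume "n \<le> a div int m"
    then have "int m * n \<le> int m * (a div int m)" using m by (intro mult_left_mono) auto
    also have "\<dots> \<le> a" using m pos_mod_sign[of "int m" a] mult_div_mod_eq[of "int m" a] by linarith
    finally show "int m * n \<le> a" .
  next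
    assume "int m * n \<le> a"
    from zdiv_mono1[OF this m] show "n \<le> a div int m" using m by simp
  qed
  have "- ((k2 + int t) div int m) \<le> j \<longleftrightarrow> - k2 \<le> int m * j + int t"
    using *[of "- j" "k2 + int t"] by (auto simp: algebra_simps)
  moreover have "j \<le> (k1 - int (Polynomial.degree f) * int t) div int m \<longleftrightarrow>
      int m * j + int (Polynomial.degree f) * int t \<le> k1"
    using * by auto
  ultimately show ?thesis by (auto simp: lattice_points_def)
qed

lemma ord_at_linear: "ord_at \<alpha> (to_fract [:- \<alpha>, 1:]) = 1"
  using ord_at_divide[of "[:- \<alpha>, 1:]" 1 \<alpha>] order_power_n_n[of \<alpha> 1] by (simp add: order_0I)

lemma ord_inf_linear: "ord_inf (to_fract [:- \<alpha>, 1:]) = - 1"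
  using ord_inf_divide[of "[:- \<alpha>, 1:]" 1] by simp

lemma ramified_valuation_monomial:
  assumes "ramified_valuation R ord s w"
  shows "w (monomial \<alpha> (t, j)) = int m * ord (to_fract [:- \<alpha>, 1:]) * j + int t * s"
proof -
  interpret discrete_valuation R w using assms by (simp add: ramified_valuation_def)
  have "w (pol [:- \<alpha>, 1:]) = int m * ord (to_fract [:- \<alpha>, 1:])"
    using assms by (simp add: ramified_valuation_def pol_def)
  then show ?thesis
    using assms z_nonzero
    by (simp add: monomial_def w_mult w_power w_power_int ramified_valuation_def mult.commute)
qed

lemma monomial_nonzero: "monomial \<alpha> p \<noteq> 0"
  using z_nonzero by (simp add: monomial_def split: prod.splits)

context
  fixes \<alpha> :: 'k and R_inf R_\<alpha> :: "'f set"
  assumes root: "poly f \<alpha> = 0"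
    and R_inf: "valuation_ring (const_emb \<phi>) R_inf" "over_infinity R_inf"
    and R_\<alpha>: "valuation_ring (const_emb \<phi>) R_\<alpha>" "over_point \<alpha> R_\<alpha>"
begin

definition divisor :: "int \<Rightarrow> int \<Rightarrow> 'f set \<Rightarrow>\<^sub>0 int" where
  "divisor k1 k2 = Poly_Mapping.single (nonunits R_inf) k1 + Poly_Mapping.single (nonunits R_\<alpha>) k2"

lemma nonunits_eq_imp_eq:
  "valuation_ring (const_emb \<phi>) R \<Longrightarrow> valuation_ring (const_emb \<phi>) S \<Longrightarrow>
    nonunits R = nonunits S \<Longrightarrow> R = S"
  by (rule valuation_subring_eq_if_nonunits_eq) (auto intro: valuation_ring_imp_valuation_subring)

lemma lookup_divisor:
  "Poly_Mapping.lookup (divisor k1 k2) (nonunits R_inf) = k1"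
  "Poly_Mapping.lookup (divisor k1 k2) (nonunits R_\<alpha>) = k2"
  "valuation_ring (const_emb \<phi>) R \<Longrightarrow> over_point \<beta> R \<Longrightarrow> \<beta> \<noteq> \<alpha> \<Longrightarrow>
     Poly_Mapping.lookup (divisor k1 k2) (nonunits R) = 0"
proof -
  have "nonunits R_inf \<noteq> nonunits R_\<alpha>"
    using nonunits_eq_imp_eq[OF R_inf(1) R_\<alpha>(1)] not_over_point_and_infinity[OF R_\<alpha>] R_inf(2) by blast
  then show "Poly_Mapping.lookup (divisor k1 k2) (nonunits R_inf) = k1"
    "Poly_Mapping.lookup (divisor k1 k2) (nonunits R_\<alpha>) = k2"
    by (auto simp: divisor_def lookup_add lookup_single when_def)
  assume R: "valuation_ring (const_emb \<phi>) R" "over_point \<beta> R" "\<beta> \<noteq> \<alpha>"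
  have "nonunits R \<noteq> nonunits R_inf"
    using nonunits_eq_imp_eq[OF R_inf(1) R(1)] not_over_point_and_infinity[OF R(1,2)] R_inf(2) by auto
  moreover have "nonunits R \<noteq> nonunits R_\<alpha>"
    using nonunits_eq_imp_eq[OF R_\<alpha>(1) R(1)] over_point_unique[OF R(1,2)] R_\<alpha>(2) R(3) by auto
  ultimately show "Poly_Mapping.lookup (divisor k1 k2) (nonunits R) = 0"
    by (auto simp: divisor_def lookup_add lookup_single when_def)
qed

lemma monomial_mem_RR_space:
  assumes "p \<in> lattice_points k1 k2"
  shows "monomial \<alpha> p \<in> RR_space (const_emb \<phi>) (divisor k1 k2)"
proof -
  obtain t j where p: "p = (t, j)" by (cases p)
  note bounds = assms[unfolded p mem_lattice_points_iff]
  have "valuation (const_emb \<phi>) P (monomial \<alpha> p) \<ge> - Poly_Mapping.lookup (divisor k1 k2) P"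
    if "place (const_emb \<phi>) P" for P
  proof -
    obtain R where R: "valuation_ring (const_emb \<phi>) R" "P = nonunits R"
      using \<open>place (const_emb \<phi>) P\<close> by (auto simp: place_iff)
    consider "over_infinity R" | "over_point \<alpha> R" | \<beta> where "over_point \<beta> R" "\<beta> \<noteq> \<alpha>"
      using over_infinity_or_point[OF R(1)] by blast
    then show ?thesis
    proof cases
      case 1
      then obtain w where w: "ramified_valuation R ord_inf (- int (Polynomial.degree f)) w"
        using ex_ramified_valuation_at_infinity[OF R(1)] by blast
      moreover have "R = R_inf"
        using valuation_ring_at_infinity_unique[OF R(1) 1 R_inf] .
      moreover have "w (monomial \<alpha> p) = - (int m * j) - int (Polynomial.degree f) * int t"
        using ramified_valuation_monomial[OF w, of \<alpha> t j] by (simp add: p ord_inf_linear)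
      ultimately show ?thesis
        using bounds R lookup_divisor(1)[of k1 k2] valuation_nonunits[OF R(1) _ monomial_nonzero, of w \<alpha> p]
        by (simp add: ramified_valuation_def)
    next
      case 2
      then obtain w where w: "ramified_valuation R (ord_at \<alpha>) 1 w"
        using ex_ramified_valuation_at_root[OF R(1) _ root] by blast
      moreover have "R = R_\<alpha>"
        using valuation_ring_at_root_unique[OF R(1) 2 R_\<alpha> root] .
      moreover have "w (monomial \<alpha> p) = int m * j + int t"
        using ramified_valuation_monomial[OF w, of \<alpha> t j] by (simp add: p ord_at_linear)
      ultimately show ?thesis
        using bounds R lookup_divisor(2)[of k1 k2] valuation_nonunits[OF R(1) _ monomial_nonzero, of w \<alpha> p]
        by (simp add: ramified_valuation_def)
    next
      case (3 \<beta>)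
      interpret valuation_subring R
        using R(1) by (rule valuation_ring_imp_valuation_subring)
      have "unit_in R (pol [:- \<alpha>, 1:] powi j)"
        by (intro unit_in_power_int unit_in_pol_if_over_point[OF R(1) 3(1)]) (use 3(2) in simp)
      moreover have "z \<in> R"
      proof -
        have "pol [:0, 1:] \<in> R"
          using over_infinity_iff[OF R(1)] not_over_point_and_infinity[OF R(1) 3(1)] by simp
        then have "z ^ m \<in> R" unfolding z_power by (rule pol_mem[OF R(1)])
        then show ?thesis by (rule mem_if_power_mem) (use m_ge_2 in simp)
      qed
      ultimately have "monomial \<alpha> p \<in> R"
        by (auto simp: p monomial_def unit_in_def intro!: mult_mem power_mem)
      then show ?thesis
        using lookup_divisor(3)[OF R(1) 3] valuation_nonneg_iff[OF R(1) monomial_nonzero] R(2) by simp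
    qed
  qed
  then show ?thesis using monomial_nonzero by (simp add: RR_space_def)
qed

text \<open>
  At the places over infinity and over the roots of \<open>f\<close> the bounds on \<open>\<Sum> g\<^sub>t z\<^sup>t\<close> are bounds on
  each term. At the others this follows by averaging, because the conjugates of a function in
  the space have no poles there either.
\<close>

lemma coordinates_RR_space:
  assumes h: "h \<in> RR_space (const_emb \<phi>) (divisor k1 k2)" "h = (\<Sum>t<m. \<phi> (g t) * z ^ t)"
    and t: "t < m" "g t \<noteq> 0"
  shows "- k1 \<le> int m * ord_inf (g t) - int (Polynomial.degree f) * int t"
    and "- k2 \<le> int m * ord_at \<alpha> (g t) + int t"
    and "\<beta> \<noteq> \<alpha> \<Longrightarrow> 0 \<le> ord_at \<beta> (g t)"
proof -
  obtain w where w: "ramified_valuation R_inf ord_inf (- int (Polynomial.degree f)) w"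
    using ex_ramified_valuation_at_infinity[OF R_inf] by blast
  have h0: "h \<noteq> 0"
    unfolding h(2) by (rule ramified_valuation_sum(1)[where g = g, OF w t])
  have val: "valuation (const_emb \<phi>) (nonunits R) h \<ge> - Poly_Mapping.lookup (divisor k1 k2) (nonunits R)"
    if "valuation_ring (const_emb \<phi>) R" for R
    using h(1) h0 that by (auto simp: RR_space_def place_iff)
  have val_w: "w h \<ge> - Poly_Mapping.lookup (divisor k1 k2) (nonunits R)"
    if "valuation_ring (const_emb \<phi>) R" "ramified_valuation R ord s w" for R ord s w
    using val[OF that(1)] valuation_nonunits[OF that(1) _ h0, of w] that(2)
    by (simp add: ramified_valuation_def)
  show "- k1 \<le> int m * ord_inf (g t) - int (Polynomial.degree f) * int t"
    using val_w[OF R_inf(1) w] ramified_valuation_sum(2)[where g = g, OF w t, of "- k1"] t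
    unfolding lookup_divisor h(2)[symmetric] by (auto simp: mult.commute)
  obtain w' where w': "ramified_valuation R_\<alpha> (ord_at \<alpha>) 1 w'"
    using ex_ramified_valuation_at_root[OF R_\<alpha> root] by blast
  show "- k2 \<le> int m * ord_at \<alpha> (g t) + int t"
    using val_w[OF R_\<alpha>(1) w'] ramified_valuation_sum(2)[where g = g, OF w' t, of "- k2"] t
    unfolding lookup_divisor h(2)[symmetric] by auto
  assume \<beta>: "\<beta> \<noteq> \<alpha>"
  obtain R where R: "valuation_ring (const_emb \<phi>) R" "over_point \<beta> R"
    using ex_valuation_ring_over_point by blast
  interpret valuation_subring R
    using R(1) by (rule valuation_ring_imp_valuation_subring)
  show "0 \<le> ord_at \<beta> (g t)"
  proof (cases "poly f \<beta> = 0")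
    case True
    obtain v where v: "ramified_valuation R (ord_at \<beta>) 1 v"
      using ex_ramified_valuation_at_root[OF R True] by blast
    have "0 \<le> int m * ord_at \<beta> (g t) + int t"
      using val_w[OF R(1) v] ramified_valuation_sum(2)[where g = g, OF v t, of 0] t
      unfolding lookup_divisor(3)[OF R \<beta>] h(2)[symmetric] by auto
    then have "int m * (- 1) < int m * ord_at \<beta> (g t)" using t(1) by simp
    then show ?thesis using m_ge_2 by (simp only: mult_less_cancel_left) simp
  next
    case False
    have conj: "conjugate \<zeta> h \<in> R" if \<zeta>: "\<zeta> ^ m = 1" for \<zeta>
    proof -
      note R' = valuation_ring_conjugate[OF \<zeta> R(1)] over_point_conjugate[OF \<zeta> R(2)]
      show ?thesis
        using val[OF R'(1)] valuation_nonneg_iff[OF R'(1) h0] lookup_divisor(3)[OF R' \<beta>] by simp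
    qed
    have "(\<Sum>\<zeta> | \<zeta> ^ m = 1. pol [:\<zeta> ^ (m - t):] * conjugate \<zeta> h) \<in> R"
      using conj by (intro sum_mem mult_mem const_mem[OF R(1)]) auto
    then have summand: "pol [:of_nat m:] * (\<phi> (g t) * z ^ t) \<in> R"
      by (simp only: average_conjugate[OF h(2) t(1)])
    have u: "unit_in R (pol [:of_nat m:] * z ^ t)"
      using of_nat_m
      by (intro unit_in_mult unit_in_power unit_in_const[OF R(1)] unit_in_z[OF R False])
    then have "inverse (pol [:of_nat m:] * z ^ t) \<in> R" by (simp only: unit_in_def)
    with summand have "(pol [:of_nat m:] * (\<phi> (g t) * z ^ t)) * inverse (pol [:of_nat m:] * z ^ t) \<in> R"
      by (rule mult_mem)
    also have "(pol [:of_nat m:] * (\<phi> (g t) * z ^ t)) * inverse (pol [:of_nat m:] * z ^ t) = \<phi> (g t)"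
      using u by (simp add: unit_in_def field_simps)
    finally have "\<phi> (g t) \<in> R" .
    moreover obtain v e where "discrete_valuation R v" "e \<in> {1..int m}"
      "v (\<phi> (g t)) = e * ord_at \<beta> (g t)"
      using ex_valuation_at_point[OF R] t(2) by blast
    ultimately show ?thesis
      using discrete_valuation.mem_iff[of R v "\<phi> (g t)"] t(2) by (simp add: zero_le_mult_iff)
  qed
qed

lemma RR_space_subset_span:
  "RR_space (const_emb \<phi>) (divisor k1 k2) \<subseteq>
    module.span (\<lambda>c h. const_emb \<phi> c * h) (monomial \<alpha> ` lattice_points k1 k2)"
proof
  interpret C: field_embedding "const_emb \<phi>"
    using field_embedding_pol_const by (simp only: const_emb_eq_pol[abs_def, symmetric])
  interpret V: vector_space "\<lambda>c h. const_emb \<phi> c * h" by (rule C.vector_space_emb)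
  fix h
  assume h: "h \<in> RR_space (const_emb \<phi>) (divisor k1 k2)"
  obtain g where g: "h = (\<Sum>t<m. \<phi> (g t) * z ^ t)" using ex_coordinates by blast
  have "\<phi> (g t) * z ^ t \<in> V.span (monomial \<alpha> ` lattice_points k1 k2)" if t: "t < m" for t
  proof (cases "g t = 0")
    case True
    then show ?thesis using V.span_zero by (simp only: emb_zero mult_zero_left)
  next
    case False
    note bounds = coordinates_RR_space[OF h g t False]
    obtain a where a: "g t = (\<Sum>j\<in>{ord_at \<alpha> (g t)..- ord_inf (g t)}.
        to_fract [:a j:] * to_fract [:- \<alpha>, 1:] powi j)"
      using ex_laurent_expansion[OF False bounds(3)] by blast
    have "\<phi> (g t) * z ^ t = (\<Sum>j\<in>{ord_at \<alpha> (g t)..- ord_inf (g t)}.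
        const_emb \<phi> (a j) * monomial \<alpha> (t, j))"
      by (subst a) (simp add: emb_sum emb_mult emb_power_int sum_distrib_right monomial_def
          pol_def ratfun_const_def mult.assoc)
    also have "\<dots> \<in> V.span (monomial \<alpha> ` lattice_points k1 k2)"
    proof (intro V.span_sum V.span_scale V.span_base imageI)
      fix j
      assume j: "j \<in> {ord_at \<alpha> (g t)..- ord_inf (g t)}"
      then have "int m * ord_at \<alpha> (g t) \<le> int m * j"
        by (intro mult_left_mono) auto
      moreover have "int m * j \<le> - (int m * ord_inf (g t))"
        unfolding mult_minus_right[symmetric] using j by (intro mult_left_mono) auto
      ultimately show "(t, j) \<in> lattice_points k1 k2"
        unfolding mem_lattice_points_iff using bounds(1,2) t by linarith
    qed
    finally show ?thesis .
  qed
  then show "h \<in> V.span (monomial \<alpha> ` lattice_points k1 k2)"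
    unfolding g by (intro V.span_sum) auto
qed

text \<open>The monomials are independent because they have distinct values at the place over \<open>\<alpha>\<close>.\<close>

lemma RR_dim_eq_card: "RR_dim (const_emb \<phi>) (divisor k1 k2) = card (lattice_points k1 k2)"
proof -
  interpret C: field_embedding "const_emb \<phi>"
    using field_embedding_pol_const by (simp only: const_emb_eq_pol[abs_def, symmetric])
  interpret V: vector_space "\<lambda>c h. const_emb \<phi> c * h" by (rule C.vector_space_emb)
  let ?S = "lattice_points k1 k2"
  obtain w where w: "ramified_valuation R_\<alpha> (ord_at \<alpha>) 1 w"
    using ex_ramified_valuation_at_root[OF R_\<alpha> root] by blast
  interpret discrete_valuation R_\<alpha> w using w by (simp add: ramified_valuation_def)
  have val: "w (monomial \<alpha> p) = int m * snd p + int (fst p)" for p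
    using ramified_valuation_monomial[OF w, of \<alpha> "fst p" "snd p"] by (simp add: ord_at_linear)
  have inj_w: "inj_on (\<lambda>p. w (monomial \<alpha> p)) ?S"
  proof (rule inj_onI)
    fix p p'
    assume p: "p \<in> ?S" "p' \<in> ?S" "w (monomial \<alpha> p) = w (monomial \<alpha> p')"
    then have lt: "fst p < m" "fst p' < m" by (auto simp: lattice_points_def)
    have eq: "int m * snd p + int (fst p) = int m * snd p' + int (fst p')"
      using p(3) unfolding val .
    have "snd q = (int m * snd q + int (fst q)) div int m"
      "int (fst q) = (int m * snd q + int (fst q)) mod int m" if "fst q < m" for q :: "nat \<times> int"
      using that by (auto simp: div_add1_eq)
    from this[OF lt(1)] this[OF lt(2)] eq show "p = p'" by (auto simp: prod_eq_iff)
  qed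
  then have inj: "inj_on (monomial \<alpha>) ?S" by (auto simp: inj_on_def)
  have indep: "V.independent (monomial \<alpha> ` ?S)"
  proof (rule V.independent_if_scalars_zero)
    show "finite (monomial \<alpha> ` ?S)" using finite_lattice_points by simp
    fix u x
    assume sum: "(\<Sum>x\<in>monomial \<alpha> ` ?S. const_emb \<phi> (u x) * x) = 0" and x: "x \<in> monomial \<alpha> ` ?S"
    show "u x = 0"
    proof (rule ccontr)
      assume "u x \<noteq> 0"
      define I where "I = {p \<in> ?S. u (monomial \<alpha> p) \<noteq> 0}"
      define c where "c p = const_emb \<phi> (u (monomial \<alpha> p)) * monomial \<alpha> p" for p
      have I: "finite I" "I \<noteq> {}"
        using finite_lattice_points x \<open>u x \<noteq> 0\<close> by (auto simp: I_def)
      have c: "c p \<noteq> 0 \<and> w (c p) = w (monomial \<alpha> p)" if "p \<in> I" for p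
      proof -
        have "unit_in R_\<alpha> (const_emb \<phi> (u (monomial \<alpha> p)))"
          unfolding const_emb_eq_pol using that by (intro unit_in_const[OF R_\<alpha>(1)]) (simp add: I_def)
        then show ?thesis
          unfolding c_def unit_in_iff_w using monomial_nonzero by (simp add: w_mult del: comp_apply)
      qed
      have "inj_on (\<lambda>p. w (c p)) I"
        using inj_w c by (auto simp: inj_on_def I_def)
      then have "(\<Sum>p\<in>I. c p) \<noteq> 0"
        using w_sum_distinct[OF I, of c] c by blast
      moreover have "(\<Sum>p\<in>I. c p) = (\<Sum>p\<in>?S. c p)"
        using finite_lattice_points by (intro sum.mono_neutral_left) (auto simp: I_def c_def ratfun_const_def)
      moreover have "(\<Sum>p\<in>?S. c p) = (\<Sum>x\<in>monomial \<alpha> ` ?S. const_emb \<phi> (u x) * x)"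
        unfolding c_def by (subst sum.reindex[OF inj]) simp
      ultimately show False using sum by simp
    qed
  qed
  have "V.dim (RR_space (const_emb \<phi>) (divisor k1 k2)) = card (monomial \<alpha> ` ?S)"
    by (rule V.basis_card_eq_dim[OF _ RR_space_subset_span indep, symmetric])
      (use monomial_mem_RR_space in blast)
  then show ?thesis
    using card_image[OF inj] by (simp add: RR_dim_def dimension_over_def)
qed

text \<open>
  The sets of lattice points are nested, so they have the same number of elements only if they
  agree in every row, and two nested intervals agree if both are empty or their ends coincide.
\<close>

lemma pure_gap_iff:
  fixes a b :: nat
  defines "A k t \<equiv> (k - int (Polynomial.degree f) * int t) div int m"
    and "B k t \<equiv> (k + int t) div int m"
  shows "pure_gap (const_emb \<phi>) (nonunits R_inf) (nonunits R_\<alpha>) a b \<longleftrightarrow>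
    (\<forall>t<m. A (int a) t + B (int b) t < 0 \<or>
       A (int a) t + B (int b) t = A (int a - 1) t + B (int b - 1) t)"
proof -
  have card_eq: "card (lattice_points k1 k2) = card (lattice_points k1' k2') \<longleftrightarrow>
      (\<forall>t<m. {- B k2 t..A k1 t} = {- B k2' t..A k1' t})" if "k1' \<le> k1" "k2' \<le> k2" for k1 k2 k1' k2'
  proof -
    have "lattice_points k1' k2' \<subseteq> lattice_points k1 k2"
      using that by (auto simp: mem_lattice_points_iff)
    then have "card (lattice_points k1 k2) = card (lattice_points k1' k2') \<longleftrightarrow>
        lattice_points k1 k2 = lattice_points k1' k2'"
      using card_subset_eq[OF finite_lattice_points] by metis
    also have "\<dots> \<longleftrightarrow> (\<forall>t<m. {- B k2 t..A k1 t} = {- B k2' t..A k1' t})"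
      unfolding lattice_points_def A_def B_def by (auto simp: set_eq_iff)
    finally show ?thesis .
  qed
  have mono: "A (k - 1) t \<le> A k t" "B (k - 1) t \<le> B k t" for k t
    using m_ge_2 by (auto simp: A_def B_def intro!: zdiv_mono1)
  have "pure_gap (const_emb \<phi>) (nonunits R_inf) (nonunits R_\<alpha>) a b \<longleftrightarrow>
      (\<forall>t<m. {- B (int b) t..A (int a) t} = {- B (int b) t..A (int a - 1) t} \<and>
        {- B (int b) t..A (int a) t} = {- B (int b - 1) t..A (int a) t})"
    unfolding pure_gap_def Let_def divisor_def[symmetric] RR_dim_eq_card
    by (subst (1 2) card_eq) auto
  also have "\<dots> \<longleftrightarrow> (\<forall>t<m. A (int a) t + B (int b) t < 0 \<or>
      A (int a) t + B (int b) t = A (int a - 1) t + B (int b - 1) t)"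
  proof -
    have "{- B (int b) t..A (int a) t} = {- B (int b) t..A (int a - 1) t} \<and>
        {- B (int b) t..A (int a) t} = {- B (int b - 1) t..A (int a) t} \<longleftrightarrow>
      A (int a) t + B (int b) t < 0 \<or>
        A (int a) t + B (int b) t = A (int a - 1) t + B (int b - 1) t" for t
      using mono(1)[of "int a" t] mono(2)[of "int b" t] unfolding Icc_eq_Icc by linarith
    then show ?thesis by simp
  qed
  finally show ?thesis .
qed

end

end


section \<open>Kummer extensions\<close>

lemma is_subfield_imp_subring_set: "is_subfield S \<Longrightarrow> subring_set S"
  by (auto simp: is_subfield_def subring_set_def)

context kummer_extension
begin

text \<open>
  If \<open>u \<lambda> = m v + 1\<close>, then \<open>z = y\<^sup>u / f\<^sup>v\<close> satisfies \<open>z\<^sup>m = f\<close> and \<open>z\<^sup>\<lambda> = y\<close>, so the exponent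
  \<open>\<lambda>\<close> may be taken to be 1.
\<close>

lemma ex_radical_generator:
  assumes "rsquarefree (map_poly to_ac f)" "Polynomial.degree f = r"
  shows "\<exists>z. radical_extension \<phi> z (map_poly to_ac f) m"
proof -
  let ?f = "map_poly to_ac f"
  have deg: "Polynomial.degree ?f = r"
    using assms(2) by (simp add: degree_map_poly)
  have f0: "?f \<noteq> 0" using assms(1) by (simp add: rsquarefree_def)
  have "coprime lam m" using coprime_m by (simp add: coprime_commute)
  then obtain u v where uv: "lam * u = m * v + 1"
    using bezout_nat[of lam m] lam_pos by auto
  define s where "s = \<phi> (to_fract ?f)"
  have s0: "s \<noteq> 0" using f0 by (simp add: s_def)
  have ym: "y ^ m = s ^ lam"
    using y_power by (simp add: s_def emb_power to_fract_power)
  then have y0: "y \<noteq> 0" using s0 m_ge_2 by (auto simp: power_0_left)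
  define z where "z = y ^ u / s ^ v"
  have "z ^ m = (y ^ m) ^ u / s ^ (m * v)"
    by (simp add: z_def power_divide flip: power_mult) (simp add: mult.commute)
  also have "\<dots> = s ^ (lam * u) / s ^ (m * v)"
    by (simp add: ym power_mult)
  also have "\<dots> = s" using s0 by (simp add: uv)
  finally have zm: "z ^ m = s" .
  have "z ^ lam = y ^ (lam * u) / (s ^ lam) ^ v"
    by (simp add: z_def power_divide mult.commute flip: power_mult)
  also have "\<dots> = y"
    using y0 by (simp add: uv power_mult flip: ym)
  finally have zl: "z ^ lam = y" .
  have "adjoin \<phi> {z} = UNIV"
  proof -
    have "UNIV \<subseteq> T" if T: "is_subfield T" "range \<phi> \<union> {z} \<subseteq> T" for T
    proof -
      have "z ^ lam \<in> T"
        using T is_subfield_imp_subring_set by (intro subring_set_power) auto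
      then have "adjoin \<phi> {y} \<subseteq> T"
        unfolding adjoin_def using T zl by (intro hull_minimal) auto
      then show ?thesis using generated by simp
    qed
    then show ?thesis unfolding adjoin_def hull_def by blast
  qed
  moreover have "of_nat m \<noteq> (0 :: 'q alg_closure)"
    using char_not_dvd by (simp add: of_nat_eq_0_iff_char_dvd)
  moreover have "coprime m (Polynomial.degree ?f)"
    using coprime_m deg by simp
  moreover have "rational_function_extension \<phi>" by unfold_locales
  ultimately have "radical_extension \<phi> z ?f m"
    unfolding radical_extension_def radical_extension_axioms_def
    using m_ge_2 assms(1) zm by (simp add: rational_function_extension.pol_def s_def)
  then show ?thesis by blast
qed

end

lemma lies_over_pole_of_x:
  fixes \<phi> :: "'k::alg_closed_field poly fract \<Rightarrow> 'f::field"
  assumes "rational_function_extension \<phi>"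
    and "pole_of ratfun_const Q ratfun_x" "lies_over \<phi> P Q"
  shows "\<exists>R. valuation_ring (const_emb \<phi>) R \<and> P = nonunits R \<and>
    rational_function_extension.over_infinity \<phi> R"
proof -
  interpret rational_function_extension \<phi> by fact
  interpret I: bounded_algebraic_extension id 1 by (rule bounded_algebraic_extension_id)
  obtain S where S: "valuation_ring ratfun_const S" "Q = nonunits S"
    using assms(2) by (auto simp: pole_of_def place_iff)
  then interpret S: valuation_subring S by (blast intro: valuation_ring_imp_valuation_subring)
  have x: "(ratfun_x :: 'k poly fract) \<noteq> 0" "valuation ratfun_const (nonunits S) ratfun_x < 0"
    using assms(2) S(2) by (auto simp: pole_of_def)
  then have "ratfun_x \<notin> S"
    using I.valuation_nonneg_iff[of S ratfun_x] S(1) by simp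
  then have "inverse ratfun_x \<in> Q"
    unfolding S(2) using x(1) by (simp add: S.mem_nonunits_iff)
  then have "\<phi> (inverse ratfun_x) \<in> P"
    using assms(3) by (auto simp: lies_over_def)
  moreover obtain R where "valuation_ring (const_emb \<phi>) R" "P = nonunits R"
    using assms(3) by (auto simp: lies_over_def place_iff)
  ultimately show ?thesis
    by (auto simp: over_infinity_def pol_def ratfun_x_def emb_inverse)
qed

theorem theorem4p4:
  fixes \<phi> :: "'q::{field,finite} alg_closure poly fract \<Rightarrow> 'f::field"
    and y :: 'f and m lam r :: nat and f :: "'q poly" and \<alpha> :: "nat \<Rightarrow> 'q alg_closure"
    and Q_inf :: "'q alg_closure poly fract set" and P_inf P :: "'f set"
    and a b :: nat
  assumes "kummer_extension \<phi> y m lam r f \<alpha>"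
    and "rsquarefree (map_poly to_ac f)" and "Polynomial.degree f = r"
    and "pole_of ratfun_const Q_inf ratfun_x" and "lies_over \<phi> P_inf Q_inf"
    and "place (const_emb \<phi>) P" and "P \<noteq> P_inf" and "totally_ramified \<phi> P"
    and "a > 0" and "b > 0"
  shows "pure_gap (const_emb \<phi>) P_inf P a b \<longleftrightarrow>
    (\<forall>t\<in>{0..m - 1}.
       let s = \<lfloor>(real a - real r * real t) / real m\<rfloor> + \<lfloor>(real b + real t) / real m\<rfloor>;
           s' = \<lfloor>(real a - 1 - real r * real t) / real m\<rfloor> + \<lfloor>(real b - 1 + real t) / real m\<rfloor>;
           C1 = s < 0;
           C2 = (s \<ge> 0 \<and> s = s')
       in (C1 \<and> \<not> C2) \<or> (\<not> C1 \<and> C2))"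
proof -
  interpret kummer_extension \<phi> y m lam r f \<alpha> by fact
  obtain z where "radical_extension \<phi> z (map_poly to_ac f) m"
    using ex_radical_generator assms(2,3) by blast
  then interpret F: radical_extension \<phi> z "map_poly to_ac f" m .
  obtain R_inf where R_inf: "valuation_ring (const_emb \<phi>) R_inf" "P_inf = nonunits R_inf"
    "F.over_infinity R_inf"
    using lies_over_pole_of_x[OF F.rational_function_extension_axioms assms(4,5)] by blast
  obtain R where R: "valuation_ring (const_emb \<phi>) R" "P = nonunits R"
    using assms(6) by (auto simp: place_iff)
  have "\<not> F.over_infinity R"
    using F.valuation_ring_at_infinity_unique[OF R(1) _ R_inf(1,3)] assms(7) R(2) R_inf(2) by blast
  then obtain \<beta> where \<beta>: "F.over_point \<beta> R"
    using F.over_infinity_or_point[OF R(1)] by blast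
  have root: "poly (map_poly to_ac f) \<beta> = 0"
    using F.totally_ramified_imp_over_root[OF R(1) _ \<beta>] assms(8) R(2) by blast
  have deg: "Polynomial.degree (map_poly to_ac f) = r"
    using assms(3) by (simp add: degree_map_poly)
  have floor: "\<lfloor>real_of_int k / real m\<rfloor> = k div int m" for k
    using floor_divide_of_int_eq[of k "int m"] by simp
  have floors:
    "\<lfloor>(real a - real r * real t) / real m\<rfloor> = (int a - int r * int t) div int m"
    "\<lfloor>(real b + real t) / real m\<rfloor> = (int b + int t) div int m"
    "\<lfloor>(real a - 1 - real r * real t) / real m\<rfloor> = (int a - 1 - int r * int t) div int m"
    "\<lfloor>(real b - 1 + real t) / real m\<rfloor> = (int b - 1 + int t) div int m" for t
    using floor[of "int a - int r * int t"] floor[of "int b + int t"]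
      floor[of "int a - 1 - int r * int t"] floor[of "int b - 1 + int t"] by simp_all
  have "{0..m - 1} = {..<m}" using m_ge_2 by auto
  then show ?thesis
    unfolding R(2) R_inf(2) F.pure_gap_iff[OF root R_inf(1,3) R(1) \<beta>] deg Let_def floors
    by (auto simp: not_less)
qed

end
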